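(* Let $k$ be a field and let $f:C\to D$ be a homomorphism of finite dimensional $k$-coalgebras. Let $\omega:\mathrm{comod}_{\rm f}(C)\to\mathrm{comod}_{\rm f}(D)$ be the functor induced by $f$. Then $f$ is injective if and only if both of the following hold: (i) $\omega$ is full; (ii) for every finite dimensional right $C$-comodule $X$ and every $D$-subcomodule $Y$ of $\omega(X)$ there exists a $C$-subcomodule $X'$ of $X$ such that $\omega(X')=Y$. (In other words, $\mathrm{comod}_{\rm f}(C)$, considered by means of $f$ as a subcategory of $\mathrm{comod}_{\rm f}(D)$, is full and closed under taking subobjects if and only if $f$ is injective.)
   Context: For a $k$-coalgebra $C$ (coassociative, counital), $\mathrm{comod}_{\rm f}(C)$ is the category of right $C$-comodules that are finite dimensional over $k$. A coalgebra homomorphism $f:C\to D$ (compatible with comultiplications and counits) induces the functor $\omega$ sending a right $C$-comodule $(X,\delta:X\to X\otimes C)$ to the $D$-comodule $(X,(\mathrm{id}\otimes f)\circ\delta)$; it is the identity on underlying vector spaces and on underlying linear maps. *)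

theory Defs
  imports "HOL-Algebra.AbelCoset" "Jordan_Normal_Form.Missing_VectorSpace"
begin

text \<open>
  Vector spaces are the \<^locale>\<open>vectorspace\<close> structures with explicit carrier. The record
  \<^type>\<open>module\<close> extends the record of rings, so each such structure also has fields
  \<^const>\<open>mult\<close> and \<^const>\<open>one\<close>; these play no role for modules and are filled with dummy values.
\<close>

subsection \<open>Tensor products\<close>

text \<open>The vector space with basis \<open>S\<close>: finitely supported functions from \<open>S\<close> to \<open>K\<close>,
  extended by zero outside \<open>S\<close>.\<close>

definition free_space :: "('k, 'm) ring_scheme \<Rightarrow> 's set \<Rightarrow> ('k, 's \<Rightarrow> 'k) module" where
  "free_space K S =
    \<lparr>carrier = {\<phi>. \<phi> \<in> UNIV \<rightarrow> carrier K \<and> finite {s. \<phi> s \<noteq> \<zero>\<^bsub>K\<^esub>} \<and> {s. \<phi> s \<noteq> \<zero>\<^bsub>K\<^esub>} \<subseteq> S},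
     mult = (\<lambda>_ _ _. \<zero>\<^bsub>K\<^esub>), one = (\<lambda>_. \<zero>\<^bsub>K\<^esub>),
     zero = (\<lambda>_. \<zero>\<^bsub>K\<^esub>),
     add = (\<lambda>\<phi> \<psi> s. \<phi> s \<oplus>\<^bsub>K\<^esub> \<psi> s),
     smult = (\<lambda>a \<phi> s. a \<otimes>\<^bsub>K\<^esub> \<phi> s)\<rparr>"

definition free_gen :: "('k, 'm) ring_scheme \<Rightarrow> 's \<Rightarrow> 's \<Rightarrow> 'k" where
  "free_gen K s = (\<lambda>t. if t = s then \<one>\<^bsub>K\<^esub> else \<zero>\<^bsub>K\<^esub>)"

definition bilinear_relations ::
  "('k, 'm) ring_scheme \<Rightarrow> ('k, 'v, 'n) module_scheme \<Rightarrow> ('k, 'w, 'o) module_scheme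
    \<Rightarrow> ('v \<times> 'w \<Rightarrow> 'k) set" where
  "bilinear_relations K V W =
    (let F = free_space K (carrier V \<times> carrier W); e = free_gen K in
      {e (v \<oplus>\<^bsub>V\<^esub> v', w) \<ominus>\<^bsub>F\<^esub> (e (v, w) \<oplus>\<^bsub>F\<^esub> e (v', w)) | v v' w.
         v \<in> carrier V \<and> v' \<in> carrier V \<and> w \<in> carrier W} \<union>
      {e (v, w \<oplus>\<^bsub>W\<^esub> w') \<ominus>\<^bsub>F\<^esub> (e (v, w) \<oplus>\<^bsub>F\<^esub> e (v, w')) | v w w'.
         v \<in> carrier V \<and> w \<in> carrier W \<and> w' \<in> carrier W} \<union>
      {e (a \<odot>\<^bsub>V\<^esub> v, w) \<ominus>\<^bsub>F\<^esub> (a \<odot>\<^bsub>F\<^esub> e (v, w)) | a v w.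
         a \<in> carrier K \<and> v \<in> carrier V \<and> w \<in> carrier W} \<union>
      {e (v, a \<odot>\<^bsub>W\<^esub> w) \<ominus>\<^bsub>F\<^esub> (a \<odot>\<^bsub>F\<^esub> e (v, w)) | a v w.
         a \<in> carrier K \<and> v \<in> carrier V \<and> w \<in> carrier W})"

definition tensor_null ::
  "('k, 'm) ring_scheme \<Rightarrow> ('k, 'v, 'n) module_scheme \<Rightarrow> ('k, 'w, 'o) module_scheme
    \<Rightarrow> ('v \<times> 'w \<Rightarrow> 'k) set" where
  "tensor_null K V W =
    module.span K (free_space K (carrier V \<times> carrier W)) (bilinear_relations K V W)"

text \<open>\<open>V \<otimes> W\<close> is the quotient of the free space on \<open>V \<times> W\<close> by the span of the bilinearity
  relations; its elements are cosets.\<close>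

definition tensor_space ::
  "('k, 'm) ring_scheme \<Rightarrow> ('k, 'v, 'n) module_scheme \<Rightarrow> ('k, 'w, 'o) module_scheme
    \<Rightarrow> ('k, ('v \<times> 'w \<Rightarrow> 'k) set) module" where
  "tensor_space K V W =
    (let F = free_space K (carrier V \<times> carrier W); N = tensor_null K V W in
      \<lparr>carrier = a_rcosets\<^bsub>F\<^esub> N,
       mult = (\<lambda>_ _. N), one = N,
       zero = N,
       add = (\<lambda>S T. S <+>\<^bsub>F\<^esub> T),
       smult = (\<lambda>a T. \<Union>\<phi>\<in>T. N +>\<^bsub>F\<^esub> (a \<odot>\<^bsub>F\<^esub> \<phi>))\<rparr>)"

definition pure_tensor ::
  "('k, 'm) ring_scheme \<Rightarrow> ('k, 'v, 'n) module_scheme \<Rightarrow> ('k, 'w, 'o) module_scheme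
    \<Rightarrow> 'v \<Rightarrow> 'w \<Rightarrow> ('v \<times> 'w \<Rightarrow> 'k) set" where
  "pure_tensor K V W v w =
    tensor_null K V W +>\<^bsub>free_space K (carrier V \<times> carrier W)\<^esub> free_gen K (v, w)"

text \<open>For \<open>\<beta>\<close> bilinear with values in \<open>U\<close>, this is the linear map with
  \<open>v \<otimes> w \<mapsto> \<beta> v w\<close>; bilinearity makes the value independent of the chosen representative.\<close>

definition tensor_lift ::
  "('k, 'm) ring_scheme \<Rightarrow> ('k, 'u, 'n) module_scheme \<Rightarrow> ('v \<Rightarrow> 'w \<Rightarrow> 'u)
    \<Rightarrow> ('v \<times> 'w \<Rightarrow> 'k) set \<Rightarrow> 'u" where
  "tensor_lift K U \<beta> T =
    (let \<phi> = (SOME \<phi>. \<phi> \<in> T) in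
      \<Oplus>\<^bsub>U\<^esub>p\<in>{p. \<phi> p \<noteq> \<zero>\<^bsub>K\<^esub>}. \<phi> p \<odot>\<^bsub>U\<^esub> \<beta> (fst p) (snd p))"

text \<open>The map \<open>g \<otimes> h\<close> with values in \<open>V' \<otimes> W'\<close>.\<close>

definition tensor_map ::
  "('k, 'm) ring_scheme \<Rightarrow> ('k, 'v2, 'n) module_scheme \<Rightarrow> ('k, 'w2, 'o) module_scheme
    \<Rightarrow> ('v \<Rightarrow> 'v2) \<Rightarrow> ('w \<Rightarrow> 'w2) \<Rightarrow> ('v \<times> 'w \<Rightarrow> 'k) set \<Rightarrow> ('v2 \<times> 'w2 \<Rightarrow> 'k) set" where
  "tensor_map K V' W' g h =
    tensor_lift K (tensor_space K V' W') (\<lambda>v w. pure_tensor K V' W' (g v) (h w))"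

text \<open>The associator \<open>(U \<otimes> V) \<otimes> W \<rightarrow> U \<otimes> (V \<otimes> W)\<close>, \<open>(u \<otimes> v) \<otimes> w \<mapsto> u \<otimes> (v \<otimes> w)\<close>.\<close>

definition tensor_assoc ::
  "('k, 'm) ring_scheme \<Rightarrow> ('k, 'u, 'n) module_scheme \<Rightarrow> ('k, 'v, 'o) module_scheme
    \<Rightarrow> ('k, 'w, 'p) module_scheme
    \<Rightarrow> (('u \<times> 'v \<Rightarrow> 'k) set \<times> 'w \<Rightarrow> 'k) set \<Rightarrow> ('u \<times> ('v \<times> 'w \<Rightarrow> 'k) set \<Rightarrow> 'k) set" where
  "tensor_assoc K U V W =
    (let VW = tensor_space K V W; UVW = tensor_space K U VW in
      tensor_lift K UVW (\<lambda>t w.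
        tensor_lift K UVW (\<lambda>u v. pure_tensor K U VW u (pure_tensor K V W v w)) t))"

text \<open>\<open>K\<close> as a vector space over itself.\<close>

definition base_space :: "('k, 'm) ring_scheme \<Rightarrow> ('k, 'k) module" where
  "base_space K =
    \<lparr>carrier = carrier K, mult = mult K, one = one K, zero = zero K, add = add K,
     smult = mult K\<rparr>"


subsection \<open>Coalgebras\<close>

record ('k, 'c) coalgebra = "('k, 'c) module" +
  comul :: "'c \<Rightarrow> ('c \<times> 'c \<Rightarrow> 'k) set"
  counit :: "'c \<Rightarrow> 'k"

text \<open>The isomorphisms \<open>C \<rightarrow> K \<otimes> C\<close> and \<open>C \<rightarrow> C \<otimes> K\<close> in the counit laws are
  \<open>c \<mapsto> 1 \<otimes> c\<close> and \<open>c \<mapsto> c \<otimes> 1\<close>.\<close>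

locale coalgebra = vectorspace K C
  for K :: "('k, 'm) ring_scheme" and C :: "('k, 'c, 'n) coalgebra_scheme" +
  assumes comul_linear: "linear_map K C (tensor_space K C C) (comul C)"
    and counit_linear: "linear_map K C (base_space K) (counit C)"
    and coassoc: "c \<in> carrier C \<Longrightarrow>
      tensor_assoc K C C C (tensor_map K (tensor_space K C C) C (comul C) (\<lambda>x. x) (comul C c)) =
      tensor_map K C (tensor_space K C C) (\<lambda>x. x) (comul C) (comul C c)"
    and counit_left: "c \<in> carrier C \<Longrightarrow>
      tensor_map K (base_space K) C (counit C) (\<lambda>x. x) (comul C c) =
      pure_tensor K (base_space K) C \<one>\<^bsub>K\<^esub> c"
    and counit_right: "c \<in> carrier C \<Longrightarrow>
      tensor_map K C (base_space K) (\<lambda>x. x) (counit C) (comul C c) =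
      pure_tensor K C (base_space K) c \<one>\<^bsub>K\<^esub>"

definition fin_dim_coalgebra ::
  "('k, 'm) ring_scheme \<Rightarrow> ('k, 'c, 'n) coalgebra_scheme \<Rightarrow> bool" where
  "fin_dim_coalgebra K C \<longleftrightarrow> coalgebra K C \<and> vectorspace.fin_dim K C"

definition coalgebra_hom ::
  "('k, 'm) ring_scheme \<Rightarrow> ('k, 'c, 'n) coalgebra_scheme \<Rightarrow> ('k, 'd, 'o) coalgebra_scheme
    \<Rightarrow> ('c \<Rightarrow> 'd) set" where
  "coalgebra_hom K C D =
    {f \<in> module_hom K C D.
      (\<forall>c\<in>carrier C. comul D (f c) = tensor_map K D D f f (comul C c)) \<and>
      (\<forall>c\<in>carrier C. counit D (f c) = counit C c)}"


subsection \<open>Right comodules\<close>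

record ('k, 'x, 'c) comodule = "('k, 'x) module" +
  coact :: "'x \<Rightarrow> ('x \<times> 'c \<Rightarrow> 'k) set"

text \<open>Coactions and comodule maps are required to be extensional, so that equality of the
  underlying HOL functions is equality of maps on the carrier; in particular an equation
  between comodules is an equation of vector spaces with coaction.\<close>

locale comodule =
  fixes K :: "('k, 'm) ring_scheme" and C :: "('k, 'c, 'n) coalgebra_scheme"
    and X :: "('k, 'x, 'c) comodule"
  assumes coalgebra: "coalgebra K C"
    and coact_linear: "linear_map K X (tensor_space K X C) (coact X)"
    and coact_extensional: "coact X \<in> extensional (carrier X)"
    and coact_coassoc: "x \<in> carrier X \<Longrightarrow>
      tensor_assoc K X C C (tensor_map K (tensor_space K X C) C (coact X) (\<lambda>c. c) (coact X x)) =
      tensor_map K X (tensor_space K C C) (\<lambda>x. x) (comul C) (coact X x)"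
    and coact_counit: "x \<in> carrier X \<Longrightarrow>
      tensor_map K X (base_space K) (\<lambda>x. x) (counit C) (coact X x) =
      pure_tensor K X (base_space K) x \<one>\<^bsub>K\<^esub>"

definition fin_dim_comodules ::
  "('k, 'm) ring_scheme \<Rightarrow> ('k, 'c, 'n) coalgebra_scheme \<Rightarrow> ('k, 'x, 'c) comodule set" where
  "fin_dim_comodules K C = {X. comodule K C X \<and> vectorspace.fin_dim K X}"

definition comodule_hom ::
  "('k, 'm) ring_scheme \<Rightarrow> ('k, 'c, 'n) coalgebra_scheme
    \<Rightarrow> ('k, 'x, 'c) comodule \<Rightarrow> ('k, 'y, 'c) comodule \<Rightarrow> ('x \<Rightarrow> 'y) set" where
  "comodule_hom K C X Y =
    {h \<in> module_hom K X Y. h \<in> extensional (carrier X) \<and>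
      (\<forall>x\<in>carrier X. coact Y (h x) = tensor_map K Y C h (\<lambda>c. c) (coact X x))}"

definition subcomodule ::
  "('k, 'm) ring_scheme \<Rightarrow> ('k, 'c, 'n) coalgebra_scheme
    \<Rightarrow> ('k, 'x, 'c) comodule \<Rightarrow> ('k, 'x, 'c) comodule \<Rightarrow> bool" where
  "subcomodule K C Y X \<longleftrightarrow>
    comodule K C X \<and> comodule K C Y \<and> subspace K (carrier Y) X \<and>
    Y = X\<lparr>carrier := carrier Y, coact := coact Y\<rparr> \<and>
    (\<lambda>y\<in>carrier Y. y) \<in> comodule_hom K C Y X"


subsection \<open>The functor induced by a coalgebra homomorphism\<close>

definition induced_obj ::
  "('k, 'm) ring_scheme \<Rightarrow> ('k, 'd, 'n) coalgebra_scheme \<Rightarrow> ('c \<Rightarrow> 'd)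
    \<Rightarrow> ('k, 'x, 'c) comodule \<Rightarrow> ('k, 'x, 'd) comodule" where
  "induced_obj K D f X =
    \<lparr>carrier = carrier X, mult = mult X, one = one X, zero = zero X, add = add X,
     smult = smult X,
     coact = (\<lambda>x\<in>carrier X. tensor_map K X D (\<lambda>x. x) f (coact X x))\<rparr>"

text \<open>The functor is the identity on underlying linear maps.\<close>

definition induced_hom :: "('x \<Rightarrow> 'y) \<Rightarrow> 'x \<Rightarrow> 'y" where
  "induced_hom h = h"


subsection \<open>Universes of comodules\<close>

text \<open>The carriers of all comodules considered are subsets of one type \<open>'x\<close>, which must be large
  enough for the comodules over it to represent all finite dimensional ones: it has to
  contain a set of the size of \<open>K\<^sup>n\<close> for every \<open>n\<close>, so that every finite dimensional \<open>K\<close>-vector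
  space is isomorphic to one with carrier in \<open>'x\<close>. The types \<open>'k list\<close> and
  \<open>nat \<Rightarrow> 'k\<close> always qualify.\<close>

definition fin_dim_universe :: "('k, 'm) ring_scheme \<Rightarrow> 'x itself \<Rightarrow> bool" where
  "fin_dim_universe K _ \<longleftrightarrow>
    (\<forall>n::nat. \<exists>e :: (nat \<Rightarrow> 'k) \<Rightarrow> 'x. inj_on e ({..<n} \<rightarrow>\<^sub>E carrier K))"

end

theory Submission
  imports Defs
begin

text \<open>
  If \<open>f\<close> is injective, choose a linear left inverse \<open>p\<close> of \<open>f\<close>. Fullness follows because
  \<open>id \<otimes> f\<close> is injective. If \<open>Y\<close> is a \<open>D\<close>-subcomodule of \<open>X\<close>, then
  \<open>(id \<otimes> p) \<circ> \<delta>\<^sub>Y\<close> maps \<open>Y\<close> into \<open>Y \<otimes> C\<close> and agrees there with the coaction of \<open>X\<close>.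

  Conversely, apply (ii) to \<open>X = C\<close>. Since \<open>(f \<otimes> f) \<circ> \<Delta> = \<Delta> \<circ> f\<close>, the kernel \<open>A\<close> of \<open>f\<close>
  is a \<open>D\<close>-subcomodule of \<open>C\<close>, so it is a \<open>C\<close>-subcomodule and \<open>\<Delta>\<close> maps \<open>A\<close> into \<open>A \<otimes> C\<close>. The counit
  of \<open>C\<close> factors through \<open>f\<close>, hence vanishes on \<open>A\<close>, and \<open>1 \<otimes> a = (\<epsilon> \<otimes> id) (\<Delta> a) = 0\<close> for \<open>a\<close> in \<open>A\<close>.
\<close>

subsection \<open>Linear maps\<close>

text \<open>Elements of a tensor product are cosets of functions on pairs, so for a subspace
  \<open>A\<close> of \<open>X\<close> the space A \<otimes> C is not a subset of X \<otimes> C.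
  That a coaction restricts to \<open>A\<close> therefore means that some linear map into A
  \<otimes> C becomes the given coaction after i \<otimes> id, where \<open>i\<close> is the
  inclusion. Such a map has to be constructed, and i \<otimes> id has to be injective. Both come
  from splittings: a linear map T into a finite dimensional space has an \<open>s\<close> with T s T
  = T. This gives left inverses of \<open>f\<close> and of inclusions, and the projection id - s T
  onto the kernel of T. Tensoring left inverses gives left inverses, so all injectivity on tensor
  products is obtained without choosing bases there. For a in ker f the element (id \<otimes> f)
  (\<Delta> a) is killed by f \<otimes> id, so (id - s f) \<otimes> id exhibits it as the image of
  an element of ker f \<otimes> D. Condition (ii) speaks of comodules with carrier in the type
  \<open>'x\<close>, whereas \<open>C\<close> lives on \<open>'c\<close>; the regular comodule is
  therefore first copied into \<open>'x\<close>, and \<open>f\<close> is replaced by its composite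
  with the isomorphism back to \<open>C\<close>.\<close>

lemma linear_mapI_module_hom:
  assumes "vectorspace K V" "vectorspace K W" "T \<in> module_hom K V W"
  shows "linear_map K V W T"
  using assms by (simp add: linear_map_def mod_hom_def mod_hom_axioms_def vectorspace_def)

lemma linear_mapI:
  assumes "vectorspace K V" "vectorspace K W"
    and "\<And>v. v \<in> carrier V \<Longrightarrow> T v \<in> carrier W"
    and "\<And>v v'. v \<in> carrier V \<Longrightarrow> v' \<in> carrier V \<Longrightarrow> T (v \<oplus>\<^bsub>V\<^esub> v') = T v \<oplus>\<^bsub>W\<^esub> T v'"
    and "\<And>a v. a \<in> carrier K \<Longrightarrow> v \<in> carrier V \<Longrightarrow> T (a \<odot>\<^bsub>V\<^esub> v) = a \<odot>\<^bsub>W\<^esub> T v"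
  shows "linear_map K V W T"
  using assms by (intro linear_mapI_module_hom) (auto simp: module_hom_def)

lemma linear_map_iff:
  "linear_map K V W T \<longleftrightarrow> vectorspace K V \<and> vectorspace K W \<and> T \<in> module_hom K V W"
  by (auto simp: linear_map_def mod_hom_def mod_hom_axioms_def vectorspace_def)

lemma
  assumes "linear_map K V W T"
  shows linear_map_dom: "vectorspace K V"
    and linear_map_cod: "vectorspace K W"
    and linear_map_closed: "v \<in> carrier V \<Longrightarrow> T v \<in> carrier W"
    and linear_map_add: "v \<in> carrier V \<Longrightarrow> v' \<in> carrier V \<Longrightarrow> T (v \<oplus>\<^bsub>V\<^esub> v') = T v \<oplus>\<^bsub>W\<^esub> T v'"
    and linear_map_smult: "a \<in> carrier K \<Longrightarrow> v \<in> carrier V \<Longrightarrow> T (a \<odot>\<^bsub>V\<^esub> v) = a \<odot>\<^bsub>W\<^esub> T v"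
    and linear_map_zero: "T \<zero>\<^bsub>V\<^esub> = \<zero>\<^bsub>W\<^esub>"
proof -
  interpret linear_map K V W T by fact
  show "vectorspace K V" "vectorspace K W" by unfold_locales
  show "v \<in> carrier V \<Longrightarrow> T v \<in> carrier W" by (rule f_im)
  show "v \<in> carrier V \<Longrightarrow> v' \<in> carrier V \<Longrightarrow> T (v \<oplus>\<^bsub>V\<^esub> v') = T v \<oplus>\<^bsub>W\<^esub> T v'" by (rule f_add)
  show "a \<in> carrier K \<Longrightarrow> v \<in> carrier V \<Longrightarrow> T (a \<odot>\<^bsub>V\<^esub> v) = a \<odot>\<^bsub>W\<^esub> T v" by (rule f_smult)
  show "T \<zero>\<^bsub>V\<^esub> = \<zero>\<^bsub>W\<^esub>" by (rule f0_is_0)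
qed

lemma linear_map_comp:
  assumes "linear_map K V W g" "linear_map K W U h"
  shows "linear_map K V U (\<lambda>v. h (g v))"
  using assms[THEN linear_map_dom] assms[THEN linear_map_cod]
  by (intro linear_mapI)
     (simp_all add: linear_map_closed[OF assms(1)] linear_map_closed[OF assms(2)]
        linear_map_add[OF assms(1)] linear_map_add[OF assms(2)]
        linear_map_smult[OF assms(1)] linear_map_smult[OF assms(2)])

lemma linear_map_id: "vectorspace K V \<Longrightarrow> linear_map K V V (\<lambda>v. v)"
  by (rule linear_mapI) auto

lemma linear_map_cong:
  assumes "linear_map K V W g" "\<And>v. v \<in> carrier V \<Longrightarrow> h v = g v"
  shows "linear_map K V W h"
proof -
  interpret linear_map K V W g by fact
  show ?thesis
    by (rule linear_mapI) (unfold_locales, simp_all add: assms(2))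
qed

lemma linear_map_sum:
  assumes g: "linear_map K V W g" and h: "linear_map K V W h"
  shows "linear_map K V W (\<lambda>v. g v \<oplus>\<^bsub>W\<^esub> h v)"
proof -
  interpret W: vectorspace K W using g by (rule linear_map_cod)
  interpret g: linear_map K V W g by fact
  interpret h: linear_map K V W h by fact
  show ?thesis
  proof (rule linear_mapI)
    fix v v' assume "v \<in> carrier V" "v' \<in> carrier V"
    then show "g (v \<oplus>\<^bsub>V\<^esub> v') \<oplus>\<^bsub>W\<^esub> h (v \<oplus>\<^bsub>V\<^esub> v') = (g v \<oplus>\<^bsub>W\<^esub> h v) \<oplus>\<^bsub>W\<^esub> (g v' \<oplus>\<^bsub>W\<^esub> h v')"
      by (simp add: W.M.a_ac g.f_im h.f_im)
  qed (unfold_locales, simp_all add: W.smult_r_distr g.f_im h.f_im)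
qed

lemma linear_map_scale:
  assumes g: "linear_map K V W g" and a: "a \<in> carrier K"
  shows "linear_map K V W (\<lambda>v. a \<odot>\<^bsub>W\<^esub> g v)"
proof -
  interpret W: vectorspace K W using g by (rule linear_map_cod)
  interpret g: linear_map K V W g by fact
  show ?thesis
  proof (rule linear_mapI)
    fix b v assume *: "b \<in> carrier K" "v \<in> carrier V"
    then show "a \<odot>\<^bsub>W\<^esub> g (b \<odot>\<^bsub>V\<^esub> v) = b \<odot>\<^bsub>W\<^esub> (a \<odot>\<^bsub>W\<^esub> g v)"
      using a by (simp add: W.smult_assoc1[symmetric] g.f_im W.R.m_comm)
  qed (unfold_locales, simp_all add: a W.smult_r_distr g.f_im)
qed

lemma linear_map_inverse:
  assumes g: "linear_map K V W g" and bij: "bij_betw g (carrier V) (carrier W)"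
  shows "linear_map K W V (inv_into (carrier V) g)"
proof -
  interpret g: linear_map K V W g by fact
  let ?h = "inv_into (carrier V) g"
  have im: "g ` carrier V = carrier W" and inj: "inj_on g (carrier V)"
    using bij by (auto simp: bij_betw_def)
  have h: "?h w \<in> carrier V" "g (?h w) = w" if "w \<in> carrier W" for w
    using that im by (auto simp: inv_into_into f_inv_into_f)
  have hI: "?h w = v" if "v \<in> carrier V" "g v = w" for v w
    using that inj by auto
  show ?thesis
    by (rule linear_mapI) (unfold_locales, auto intro!: hI simp: h)
qed

text \<open>Every vector space axiom is an equation or a closure property, and these pass to the
  image of a surjection that respects the operations. \<open>Q\<close> is only a record beforehand,
  so the lemma yields at once that \<open>Q\<close> is a vector space and that \<open>h\<close> is
  linear. It serves quotients, relabelled copies and records with the same relevant fields.\<close>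

lemma vectorspace_surj_image:
  assumes "vectorspace K V"
    and im: "h ` carrier V = carrier Q"
    and add: "\<And>v w. v \<in> carrier V \<Longrightarrow> w \<in> carrier V \<Longrightarrow> h (v \<oplus>\<^bsub>V\<^esub> w) = h v \<oplus>\<^bsub>Q\<^esub> h w"
    and smult: "\<And>a v. a \<in> carrier K \<Longrightarrow> v \<in> carrier V \<Longrightarrow> h (a \<odot>\<^bsub>V\<^esub> v) = a \<odot>\<^bsub>Q\<^esub> h v"
    and zero: "h \<zero>\<^bsub>V\<^esub> = \<zero>\<^bsub>Q\<^esub>"
  shows "linear_map K V Q h"
proof -
  interpret V: vectorspace K V by fact
  note add' = add[symmetric] and smult' = smult[symmetric] and zero' = zero[symmetric]
  have "vectorspace K Q"
  proof (rule vs_criteria)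
    show "field K" by unfold_locales
    show "\<zero>\<^bsub>Q\<^esub> \<in> carrier Q" using im zero by force
    show "\<forall>v w. v \<in> carrier Q \<and> w \<in> carrier Q \<longrightarrow> v \<oplus>\<^bsub>Q\<^esub> w \<in> carrier Q"
      unfolding im[symmetric] by (auto simp: add')
    show "\<forall>v\<in>carrier Q. \<exists>neg_v\<in>carrier Q. v \<oplus>\<^bsub>Q\<^esub> neg_v = \<zero>\<^bsub>Q\<^esub>"
      unfolding im[symmetric]
      by (auto simp: add' zero' intro!: arg_cong[of _ _ h] bexI[of _ "\<ominus>\<^bsub>V\<^esub> _"] V.M.r_neg)
    show "\<forall>c v. c \<in> carrier K \<and> v \<in> carrier Q \<longrightarrow> c \<odot>\<^bsub>Q\<^esub> v \<in> carrier Q"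
      unfolding im[symmetric] by (auto simp: smult')
    show "\<forall>v w. v \<in> carrier Q \<and> w \<in> carrier Q \<longrightarrow> v \<oplus>\<^bsub>Q\<^esub> w = w \<oplus>\<^bsub>Q\<^esub> v"
      unfolding im[symmetric] by (auto simp: add' V.M.a_comm)
    show "\<forall>v w x. v \<in> carrier Q \<and> w \<in> carrier Q \<and> x \<in> carrier Q \<longrightarrow>
        v \<oplus>\<^bsub>Q\<^esub> w \<oplus>\<^bsub>Q\<^esub> x = v \<oplus>\<^bsub>Q\<^esub> (w \<oplus>\<^bsub>Q\<^esub> x)"
      unfolding im[symmetric] by (auto simp: add' V.M.a_assoc)
    show "\<forall>v\<in>carrier Q. v \<oplus>\<^bsub>Q\<^esub> \<zero>\<^bsub>Q\<^esub> = v"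
      unfolding im[symmetric] by (auto simp: add' zero')
    show "\<forall>a b v. a \<in> carrier K \<and> b \<in> carrier K \<and> v \<in> carrier Q \<longrightarrow>
        a \<otimes>\<^bsub>K\<^esub> b \<odot>\<^bsub>Q\<^esub> v = a \<odot>\<^bsub>Q\<^esub> (b \<odot>\<^bsub>Q\<^esub> v)"
      unfolding im[symmetric] by (auto simp: smult' V.smult_assoc1)
    show "\<forall>v\<in>carrier Q. \<one>\<^bsub>K\<^esub> \<odot>\<^bsub>Q\<^esub> v = v"
      unfolding im[symmetric] by (auto simp: smult')
    show "\<forall>a b v. a \<in> carrier K \<and> b \<in> carrier K \<and> v \<in> carrier Q \<longrightarrow>
        (a \<oplus>\<^bsub>K\<^esub> b) \<odot>\<^bsub>Q\<^esub> v = a \<odot>\<^bsub>Q\<^esub> v \<oplus>\<^bsub>Q\<^esub> b \<odot>\<^bsub>Q\<^esub> v"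
      unfolding im[symmetric] by (auto simp: smult' add' V.smult_l_distr)
    show "\<forall>a v w. a \<in> carrier K \<and> v \<in> carrier Q \<and> w \<in> carrier Q \<longrightarrow>
        a \<odot>\<^bsub>Q\<^esub> (v \<oplus>\<^bsub>Q\<^esub> w) = a \<odot>\<^bsub>Q\<^esub> v \<oplus>\<^bsub>Q\<^esub> a \<odot>\<^bsub>Q\<^esub> w"
      unfolding im[symmetric] by (auto simp: smult' add' V.smult_r_distr)
  qed
  then show ?thesis
    using assms(1) im by (intro linear_mapI) (auto simp: add smult)
qed

section \<open>Bases and splittings of linear maps\<close>

lemma (in vectorspace) finite_basis_extend:
  assumes "fin_dim" "A \<subseteq> carrier V" "lin_indpt A"
  obtains B where "finite B" "A \<subseteq> B" "basis B"
proof -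
  let ?P = "\<lambda>S. A \<subseteq> S \<and> S \<subseteq> carrier V \<and> lin_indpt S"
  have "\<exists>B. finite B \<and> maximal B ?P"
  proof (rule maximal_exists)
    show "finite S \<and> card S \<le> dim" if "?P S" for S
      using that by (simp add: li_le_dim[OF assms(1)])
    show "?P A" using assms by blast
  qed
  then obtain B where B: "finite B" "maximal B ?P" by blast
  \<comment> \<open>Any set above \<open>B\<close> contains \<open>A\<close> as well, so maximality
    among the independent sets containing \<open>A\<close> is maximality among all of them.\<close>
  from B(2) have "maximal B (\<lambda>S. S \<subseteq> carrier V \<and> lin_indpt S)"
    unfolding maximal_def by (metis subset_trans)
  then have "basis B" by (rule max_li_is_basis)
  with B show ?thesis
    unfolding maximal_def by (metis that)
qed

text \<open>Independent subsets of \<open>U\<close> have bounded cardinality, so a maximal one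
  exists; a vector of \<open>U\<close> outside its span could still be added to it. Finding
  \<open>A\<close> inside the ambient space keeps it ready for extension to a basis of
  \<open>V\<close>.\<close>

lemma (in vectorspace) lin_indpt_spanning_exists:
  assumes "fin_dim" "submodule K U V"
  obtains A where "A \<subseteq> U" "lin_indpt A" "span A = U"
proof -
  have U: "U \<subseteq> carrier V" using assms(2) by (simp add: submodule_def)
  let ?P = "\<lambda>S. S \<subseteq> U \<and> lin_indpt S"
  have "\<exists>A. finite A \<and> maximal A ?P"
  proof (rule maximal_exists)
    show "finite S \<and> card S \<le> dim" if "?P S" for S
      using subset_trans[OF conjunct1[OF that] U] that by (simp add: li_le_dim[OF assms(1)])
    show "?P {}" by (auto simp: lin_dep_def)
  qed
  then obtain A where A: "finite A" "maximal A ?P" by blast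
  then have AU: "A \<subseteq> U" "lin_indpt A" by (simp_all add: maximal_def)
  have "U \<subseteq> span A"
  proof
    fix u assume u: "u \<in> U"
    show "u \<in> span A"
    proof (rule ccontr)
      assume n: "u \<notin> span A"
      then have "u \<notin> A" using in_own_span[of A] AU U by auto
      with n have "lin_indpt (A \<union> {u})"
        using lin_dep_iff_in_span[of A u] AU U u by auto
      moreover have "A \<subseteq> A \<union> {u}" "A \<union> {u} \<subseteq> U" using AU u by auto
      ultimately show False using A(2) \<open>u \<notin> A\<close> unfolding maximal_def by (metis UnI2 insertI1)
    qed
  qed
  moreover have "span A \<subseteq> U"
    by (rule span_is_subset) (use AU assms in auto)
  ultimately show ?thesis using AU that by blast
qed

text \<open>The map \<open>?L\<close> from coordinate functions to vectors is a linear bijection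
  because \<open>B\<close> is a basis. Its inverse, followed by the combination \<open>?G\<close> of
  the prescribed values, is the required extension.\<close>

lemma linear_map_from_basis:
  assumes W: "vectorspace K W" and V: "vectorspace K V"
    and B: "finite B" "vectorspace.basis K W B"
    and g: "\<And>b. b \<in> B \<Longrightarrow> g b \<in> carrier V"
  obtains s where "linear_map K W V s" "\<And>b. b \<in> B \<Longrightarrow> s b = g b"
proof -
  interpret W: vectorspace K W by fact
  interpret V: vectorspace K V by fact
  let ?F = "W.func_space B"
  let ?L = "\<lambda>a. W.lincomb a B"
  let ?G = "\<lambda>a. \<Oplus>\<^bsub>V\<^esub>b\<in>B. a b \<odot>\<^bsub>V\<^esub> g b"
  have BW: "B \<subseteq> carrier W" using B by (simp add: W.basis_def)
  have L: "linear_map K ?F W ?L"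
    by (rule W.lincomb_is_linear[OF B(1) BW])
  have F: "carrier ?F = B \<rightarrow>\<^sub>E carrier K" by (simp add: W.func_space_def)
  have bij: "bij_betw ?L (carrier ?F) (carrier W)"
    unfolding bij_betw_def F
  proof
    have ex: "\<exists>!a. a \<in> B \<rightarrow>\<^sub>E carrier K \<and> ?L a = v" if "v \<in> carrier W" for v
      using W.basis_criterion[OF B(1) BW] B(2) that by blast
    have cl: "?L a \<in> carrier W" if "a \<in> B \<rightarrow>\<^sub>E carrier K" for a
      using BW that by (intro W.lincomb_closed) auto
    show "inj_on ?L (B \<rightarrow>\<^sub>E carrier K)"
      by (rule inj_onI) (use ex cl in metis)
    show "?L ` (B \<rightarrow>\<^sub>E carrier K) = carrier W"
      using ex cl by (auto simp: image_iff) metis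
  qed
  have G: "linear_map K ?F V ?G"
  proof (rule linear_mapI)
    show "vectorspace K ?F" by (rule W.func_space_is_vs)
    show "vectorspace K V" by fact
    fix a assume a: "a \<in> carrier ?F"
    then have a': "a b \<in> carrier K" if "b \<in> B" for b using that by (auto simp: F)
    show "?G a \<in> carrier V" using a' g by (intro V.M.finsum_closed) auto
    { fix c assume c: "c \<in> carrier ?F"
      then have c': "c b \<in> carrier K" if "b \<in> B" for b using that by (auto simp: F)
      have "?G (a \<oplus>\<^bsub>?F\<^esub> c) = (\<Oplus>\<^bsub>V\<^esub>b\<in>B. a b \<odot>\<^bsub>V\<^esub> g b \<oplus>\<^bsub>V\<^esub> c b \<odot>\<^bsub>V\<^esub> g b)"
        using a' c' g by (intro V.M.finsum_cong') (auto simp: W.func_space_def V.smult_l_distr)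
      also have "\<dots> = ?G a \<oplus>\<^bsub>V\<^esub> ?G c"
        using a' c' g by (intro V.M.finsum_addf) auto
      finally show "?G (a \<oplus>\<^bsub>?F\<^esub> c) = ?G a \<oplus>\<^bsub>V\<^esub> ?G c" . }
    { fix r assume r: "r \<in> carrier K"
      have "?G (r \<odot>\<^bsub>?F\<^esub> a) = (\<Oplus>\<^bsub>V\<^esub>b\<in>B. r \<odot>\<^bsub>V\<^esub> (a b \<odot>\<^bsub>V\<^esub> g b))"
        using a' r g by (intro V.M.finsum_cong') (auto simp: W.func_space_def V.smult_assoc1)
      also have "\<dots> = r \<odot>\<^bsub>V\<^esub> ?G a"
        using a' r g by (intro V.finsum_smult[symmetric]) auto
      finally show "?G (r \<odot>\<^bsub>?F\<^esub> a) = r \<odot>\<^bsub>V\<^esub> ?G a" . }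
  qed
  let ?s = "\<lambda>w. ?G (inv_into (carrier ?F) ?L w)"
  show ?thesis
  proof (rule that)
    show "linear_map K W V ?s"
      by (rule linear_map_comp[OF linear_map_inverse[OF L bij] G])
    fix b assume b: "b \<in> B"
    \<comment> \<open>The coordinate function of the basis vector \<open>b\<close>.\<close>
    let ?d = "\<lambda>v\<in>B. if v = b then \<one>\<^bsub>K\<^esub> else \<zero>\<^bsub>K\<^esub>"
    have d: "?d \<in> carrier ?F" by (auto simp: F)
    have "?L ?d = (\<Oplus>\<^bsub>W\<^esub>v\<in>B. if b = v then v else \<zero>\<^bsub>W\<^esub>)"
      unfolding W.lincomb_def using BW by (intro W.M.finsum_cong') auto
    also have "\<dots> = b" using B b BW by (intro W.M.finsum_singleton) auto
    finally have "inv_into (carrier ?F) ?L b = ?d"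
      using bij d by (metis (no_types, lifting) bij_betw_inv_into_left)
    moreover have "?G ?d = (\<Oplus>\<^bsub>V\<^esub>v\<in>B. if b = v then g v else \<zero>\<^bsub>V\<^esub>)"
      using g by (intro V.M.finsum_cong') auto
    moreover have "\<dots> = g b" using B b g by (intro V.M.finsum_singleton) auto
    ultimately show "?s b = g b" by simp
  qed
qed

text \<open>A basis of the image is sent to chosen preimages, and the vectors that complete it to a
  basis of \<open>W\<close> are sent to zero. If \<open>T\<close> is injective, \<open>s\<close> is
  a left inverse; for any \<open>T\<close>, the map id - s T is a projection onto the kernel. Both
  uses occur below.\<close>

lemma linear_map_generalized_inverse:
  assumes T: "linear_map K V W T" and fin: "vectorspace.fin_dim K W"
  obtains s where "linear_map K W V s" "\<And>v. v \<in> carrier V \<Longrightarrow> T (s (T v)) = T v"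
proof -
  interpret W: vectorspace K W using T by (rule linear_map_cod)
  interpret V: vectorspace K V using T by (rule linear_map_dom)
  interpret T: linear_map K V W T by fact
  have V: "vectorspace K V" and W: "vectorspace K W" by unfold_locales
  obtain A where A: "A \<subseteq> T.im" "W.lin_indpt A" "W.span A = T.im"
    using W.lin_indpt_spanning_exists[OF fin T.im_is_submodule] by blast
  have imW: "T.im \<subseteq> carrier W" using T.im_is_submodule by (simp add: submodule_def)
  obtain B where B: "finite B" "A \<subseteq> B" "W.basis B"
    using W.finite_basis_extend[OF fin _ A(2)] A(1) imW by blast
  define g where "g b = (if b \<in> A then inv_into (carrier V) T b else \<zero>\<^bsub>V\<^esub>)" for b
  have g: "g b \<in> carrier V" for b
    using A(1) by (auto simp: g_def T.im_def intro!: inv_into_into)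
  obtain s where s: "linear_map K W V s" and sB: "\<And>b. b \<in> B \<Longrightarrow> s b = g b"
    using linear_map_from_basis[OF W V B(1,3), of g] g by metis
  interpret s: linear_map K W V s by fact
  \<comment> \<open>This is a subspace and it contains \<open>A\<close>, hence it contains the span
    of \<open>A\<close>, which is the image of \<open>T\<close>. No expansion in coordinates is
    needed.\<close>
  let ?E = "{w \<in> carrier W. T (s w) = w}"
  have "submodule K ?E W"
    by (unfold_locales) (auto simp: s.f_im)
  moreover have "A \<subseteq> ?E"
    using A(1) B(2) imW by (auto simp: sB g_def subset_iff T.im_def f_inv_into_f)
  ultimately have "T.im \<subseteq> ?E"
    using W.span_is_subset[of A ?E] A(3) by simp
  then have "T (s (T v)) = T v" if "v \<in> carrier V" for v
    using that by (auto simp: T.im_def)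
  with s show ?thesis by (rule that)
qed

lemma injective_linear_map_left_inverse:
  assumes T: "linear_map K V W T" and inj: "inj_on T (carrier V)" and fin: "vectorspace.fin_dim K W"
  obtains s where "linear_map K W V s" "\<And>v. v \<in> carrier V \<Longrightarrow> s (T v) = v"
proof -
  obtain s where s: "linear_map K W V s" and TsT: "\<And>v. v \<in> carrier V \<Longrightarrow> T (s (T v)) = T v"
    using linear_map_generalized_inverse[OF T fin] by blast
  have "s (T v) = v" if "v \<in> carrier V" for v
    using inj_onD[OF inj TsT[OF that]] that linear_map_closed[OF s] linear_map_closed[OF T] by simp
  with s show ?thesis by (rule that)
qed

subsection \<open>Quotients and free vector spaces\<close>

text \<open>The body copies the record in \<open>tensor_space\<close> for an arbitrary subspace
  \<open>N\<close>, so that a tensor product is literally an instance and the coset arithmetic is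
  done without reference to tensors.\<close>

definition quotient_space ::
  "('k, 'v, 'n) module_scheme \<Rightarrow> 'v set \<Rightarrow> ('k, 'v set) module" where
  "quotient_space M N =
    \<lparr>carrier = a_rcosets\<^bsub>M\<^esub> N, mult = (\<lambda>_ _. N), one = N, zero = N,
     add = (\<lambda>S T. S <+>\<^bsub>M\<^esub> T), smult = (\<lambda>a T. \<Union>v\<in>T. N +>\<^bsub>M\<^esub> (a \<odot>\<^bsub>M\<^esub> v))\<rparr>"

lemma quotient_space_projection:
  assumes M: "vectorspace K M" and N: "submodule K N M"
  shows "linear_map K M (quotient_space M N) (\<lambda>v. N +>\<^bsub>M\<^esub> v)"
    and "v \<in> N \<Longrightarrow> N +>\<^bsub>M\<^esub> v = N"
    and "v \<in> carrier M \<Longrightarrow> w \<in> N +>\<^bsub>M\<^esub> v \<longleftrightarrow> w \<in> carrier M \<and> w \<ominus>\<^bsub>M\<^esub> v \<in> N"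
    and "carrier (quotient_space M N) = (\<lambda>v. N +>\<^bsub>M\<^esub> v) ` carrier M"
proof -
  interpret M: vectorspace K M by fact
  interpret N: submodule K N M by fact
  have sub: "subgroup N (add_monoid M)"
  proof
    fix x assume x: "x \<in> N"
    then have "x \<in> carrier M" using N.subset by auto
    then have "\<ominus>\<^bsub>M\<^esub> x = (\<ominus>\<^bsub>K\<^esub> \<one>\<^bsub>K\<^esub>) \<odot>\<^bsub>M\<^esub> x" by (simp add: M.smult_minus_1)
    also have "\<dots> \<in> N" using x by (intro N.smult_closed) simp_all
    finally show "inv\<^bsub>add_monoid M\<^esub> x \<in> N" by (simp add: a_inv_def)
  qed (use N.subset in auto)
  interpret A: abelian_subgroup N M
    by (rule abelian_subgroupI3[OF additive_subgroupI[OF sub]]) unfold_locales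
  show im: "carrier (quotient_space M N) = (\<lambda>v. N +>\<^bsub>M\<^esub> v) ` carrier M"
    by (auto simp: quotient_space_def A_RCOSETS_def')
  show mem: "w \<in> N +>\<^bsub>M\<^esub> v \<longleftrightarrow> w \<in> carrier M \<and> w \<ominus>\<^bsub>M\<^esub> v \<in> N" if "v \<in> carrier M" for v w
  proof
    assume "w \<in> N +>\<^bsub>M\<^esub> v"
    then show "w \<in> carrier M \<and> w \<ominus>\<^bsub>M\<^esub> v \<in> N"
      using that A.a_elemrcos_carrier[of v w] A.a_rcos_module_imp[of v w] by (simp add: a_minus_def)
  next
    assume "w \<in> carrier M \<and> w \<ominus>\<^bsub>M\<^esub> v \<in> N"
    then show "w \<in> N +>\<^bsub>M\<^esub> v"
      using that A.a_rcos_module_rev[of v w] by (simp add: a_minus_def)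
  qed
  show zero: "N +>\<^bsub>M\<^esub> v = N" if "v \<in> N" for v
    using that by (rule A.a_rcos_const)
  show "linear_map K M (quotient_space M N) (\<lambda>v. N +>\<^bsub>M\<^esub> v)"
  proof (rule vectorspace_surj_image[OF M im[symmetric]])
    fix v w assume "v \<in> carrier M" "w \<in> carrier M"
    then show "N +>\<^bsub>M\<^esub> (v \<oplus>\<^bsub>M\<^esub> w) = (N +>\<^bsub>M\<^esub> v) \<oplus>\<^bsub>quotient_space M N\<^esub> (N +>\<^bsub>M\<^esub> w)"
      by (simp add: quotient_space_def A.a_rcos_sum)
  next
    fix a v assume a: "a \<in> carrier K" and v: "v \<in> carrier M"
    \<comment> \<open>A scalar multiple of a coset is defined as a union over all its
      representatives. The union collapses to one coset because two representatives differ by an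
      element of \<open>N\<close>, and so do their multiples.\<close>
    have eq: "N +>\<^bsub>M\<^esub> (a \<odot>\<^bsub>M\<^esub> w) = N +>\<^bsub>M\<^esub> (a \<odot>\<^bsub>M\<^esub> v)" if w: "w \<in> N +>\<^bsub>M\<^esub> v" for w
    proof -
      have w': "w \<in> carrier M" "w \<ominus>\<^bsub>M\<^esub> v \<in> N" using w v mem by auto
      have "a \<odot>\<^bsub>M\<^esub> w \<ominus>\<^bsub>M\<^esub> a \<odot>\<^bsub>M\<^esub> v = a \<odot>\<^bsub>M\<^esub> (w \<ominus>\<^bsub>M\<^esub> v)"
        using a v w' by (simp add: a_minus_def M.smult_r_distr M.smult_r_minus)
      also have "\<dots> \<in> N" using a w' by simp
      finally have "a \<odot>\<^bsub>M\<^esub> w \<in> N +>\<^bsub>M\<^esub> (a \<odot>\<^bsub>M\<^esub> v)" using mem a v w' by simp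
      then show ?thesis using A.a_repr_independence'[of "a \<odot>\<^bsub>M\<^esub> w" "a \<odot>\<^bsub>M\<^esub> v"] a v by simp
    qed
    have "(\<Union>w\<in>N +>\<^bsub>M\<^esub> v. N +>\<^bsub>M\<^esub> (a \<odot>\<^bsub>M\<^esub> w)) = (\<Union>w\<in>N +>\<^bsub>M\<^esub> v. N +>\<^bsub>M\<^esub> (a \<odot>\<^bsub>M\<^esub> v))"
      by (rule SUP_cong[OF refl eq])
    also have "\<dots> = N +>\<^bsub>M\<^esub> (a \<odot>\<^bsub>M\<^esub> v)"
      using A.a_rcos_self[OF v] by blast
    finally show "N +>\<^bsub>M\<^esub> (a \<odot>\<^bsub>M\<^esub> v) = a \<odot>\<^bsub>quotient_space M N\<^esub> (N +>\<^bsub>M\<^esub> v)"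
      by (simp add: quotient_space_def)
  qed (use zero in \<open>simp add: quotient_space_def\<close>)
qed

section \<open>The universal property of free vector spaces\<close>

lemma vectorspace_free_space:
  assumes "field K"
  shows "vectorspace K (free_space K S)"
proof -
  interpret K: field K by fact
  have sup: "finite {s. \<phi> s \<oplus>\<^bsub>K\<^esub> \<psi> s \<noteq> \<zero>\<^bsub>K\<^esub>}"
    if "finite {s. \<phi> s \<noteq> \<zero>\<^bsub>K\<^esub>}" "finite {s. \<psi> s \<noteq> \<zero>\<^bsub>K\<^esub>}" for \<phi> \<psi>
    by (rule finite_subset[OF _ finite_UnI[OF that]]) auto
  have sup': "finite {s. a \<otimes>\<^bsub>K\<^esub> \<phi> s \<noteq> \<zero>\<^bsub>K\<^esub>}"
    if "finite {s. \<phi> s \<noteq> \<zero>\<^bsub>K\<^esub>}" "a \<in> carrier K" for \<phi> a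
    by (rule finite_subset[OF _ that(1)]) (use that in auto)
  have nz: "x \<noteq> \<zero>\<^bsub>K\<^esub> \<or> y \<noteq> \<zero>\<^bsub>K\<^esub>" if "x \<oplus>\<^bsub>K\<^esub> y \<noteq> \<zero>\<^bsub>K\<^esub>" for x y
    using that by auto
  have nz': "x \<noteq> \<zero>\<^bsub>K\<^esub>" if "a \<otimes>\<^bsub>K\<^esub> x \<noteq> \<zero>\<^bsub>K\<^esub>" "a \<in> carrier K" for a x
    using that by auto
  show ?thesis
  proof (rule vs_criteria)
    let ?F = "free_space K S"
    show "\<forall>v\<in>carrier ?F. \<exists>neg_v\<in>carrier ?F. v \<oplus>\<^bsub>?F\<^esub> neg_v = \<zero>\<^bsub>?F\<^esub>"
    proof
      fix v assume "v \<in> carrier ?F"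
      then have v: "\<And>s. v s \<in> carrier K" "finite {s. v s \<noteq> \<zero>\<^bsub>K\<^esub>}" "{s. v s \<noteq> \<zero>\<^bsub>K\<^esub>} \<subseteq> S"
        by (auto simp: free_space_def)
      have "{s. \<ominus>\<^bsub>K\<^esub> v s \<noteq> \<zero>\<^bsub>K\<^esub>} \<subseteq> {s. v s \<noteq> \<zero>\<^bsub>K\<^esub>}" by auto
      with v(2,3) have "finite {s. \<ominus>\<^bsub>K\<^esub> v s \<noteq> \<zero>\<^bsub>K\<^esub>}" "{s. \<ominus>\<^bsub>K\<^esub> v s \<noteq> \<zero>\<^bsub>K\<^esub>} \<subseteq> S"
        by (auto intro: finite_subset)
      with v(1) show "\<exists>neg_v\<in>carrier ?F. v \<oplus>\<^bsub>?F\<^esub> neg_v = \<zero>\<^bsub>?F\<^esub>"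
        by (intro bexI[of _ "\<lambda>s. \<ominus>\<^bsub>K\<^esub> v s"]) (auto simp: free_space_def K.r_neg)
    qed
  qed (use assms sup sup' in \<open>auto 0 3 simp: free_space_def fun_eq_iff Pi_iff K.a_ac K.m_assoc
         K.l_distr K.r_distr subset_iff dest: nz nz'\<close>)
qed

lemma free_gen_closed:
  assumes "field K" "s \<in> S"
  shows "free_gen K s \<in> carrier (free_space K S)"
proof -
  interpret K: field K by fact
  have "{t. free_gen K s t \<noteq> \<zero>\<^bsub>K\<^esub>} \<subseteq> {s}" by (auto simp: free_gen_def)
  then show ?thesis
    using assms(2) by (auto simp: free_space_def free_gen_def intro: finite_subset)
qed

text \<open>The linear extension of \<open>g\<close> from generators to the free space. It is the
  sum inside \<open>tensor_lift\<close>, taken at a given function instead of a chosen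
  representative of a coset.\<close>

definition free_eval ::
  "('k, 'm) ring_scheme \<Rightarrow> ('k, 'u, 'n) module_scheme \<Rightarrow> ('s \<Rightarrow> 'u) \<Rightarrow> ('s \<Rightarrow> 'k) \<Rightarrow> 'u" where
  "free_eval K U g \<phi> = (\<Oplus>\<^bsub>U\<^esub>p\<in>{p. \<phi> p \<noteq> \<zero>\<^bsub>K\<^esub>}. \<phi> p \<odot>\<^bsub>U\<^esub> g p)"

text \<open>Terms outside the support vanish. A common index set makes the sums for two functions
  and for their sum comparable, although cancellation may shrink the support of the latter.\<close>

lemma free_eval_superset:
  assumes U: "vectorspace K U" and g: "\<And>p. p \<in> S \<Longrightarrow> g p \<in> carrier U"
    and \<phi>: "\<phi> \<in> carrier (free_space K S)"
    and T: "finite T" "T \<subseteq> S" "{p. \<phi> p \<noteq> \<zero>\<^bsub>K\<^esub>} \<subseteq> T"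
  shows "free_eval K U g \<phi> = (\<Oplus>\<^bsub>U\<^esub>p\<in>T. \<phi> p \<odot>\<^bsub>U\<^esub> g p)"
proof -
  interpret U: vectorspace K U by fact
  show ?thesis
    unfolding free_eval_def
    by (rule U.M.add.finprod_mono_neutral_cong_left)
       (use g \<phi> T in \<open>auto simp: free_space_def subset_iff Pi_iff\<close>)
qed

lemma
  assumes U: "vectorspace K U" and g: "\<And>p. p \<in> S \<Longrightarrow> g p \<in> carrier U"
  shows linear_map_free_eval: "linear_map K (free_space K S) U (free_eval K U g)"
    and free_eval_gen: "s \<in> S \<Longrightarrow> free_eval K U g (free_gen K s) = g s"
proof -
  interpret U: vectorspace K U by fact
  have K: "field K" by unfold_locales
  let ?F = "free_space K S"
  show "linear_map K ?F U (free_eval K U g)"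
  proof (rule linear_mapI[OF vectorspace_free_space[OF K] U])
    fix \<phi> assume \<phi>: "\<phi> \<in> carrier ?F"
    let ?T = "{p. \<phi> p \<noteq> \<zero>\<^bsub>K\<^esub>}"
    have T: "finite ?T" "?T \<subseteq> S" and c: "\<And>p. \<phi> p \<in> carrier K"
      using \<phi> by (auto simp: free_space_def)
    show "free_eval K U g \<phi> \<in> carrier U"
      unfolding free_eval_def using T c g by (intro U.M.finsum_closed) auto
    { fix \<psi> assume \<psi>: "\<psi> \<in> carrier ?F"
      let ?T' = "{p. \<psi> p \<noteq> \<zero>\<^bsub>K\<^esub>}"
      have T': "finite ?T'" "?T' \<subseteq> S" and c': "\<And>p. \<psi> p \<in> carrier K"
        using \<psi> by (auto simp: free_space_def)
      have s: "\<phi> \<oplus>\<^bsub>?F\<^esub> \<psi> \<in> carrier ?F"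
        using vectorspace_free_space[OF K, of S] \<phi> \<psi> unfolding vectorspace_def module_def
        by (metis abelian_group.axioms(1) abelian_monoid.a_closed)
      have e: "(\<phi> \<oplus>\<^bsub>?F\<^esub> \<psi>) p = \<phi> p \<oplus>\<^bsub>K\<^esub> \<psi> p" for p by (simp add: free_space_def)
      let ?A = "?T \<union> ?T'"
      have A: "finite ?A" "?A \<subseteq> S" using T T' by auto
      have "free_eval K U g (\<phi> \<oplus>\<^bsub>?F\<^esub> \<psi>) = (\<Oplus>\<^bsub>U\<^esub>p\<in>?A. (\<phi> \<oplus>\<^bsub>?F\<^esub> \<psi>) p \<odot>\<^bsub>U\<^esub> g p)"
        by (rule free_eval_superset[OF U _ s A]) (auto simp: e g)
      also have "\<dots> = (\<Oplus>\<^bsub>U\<^esub>p\<in>?A. \<phi> p \<odot>\<^bsub>U\<^esub> g p \<oplus>\<^bsub>U\<^esub> \<psi> p \<odot>\<^bsub>U\<^esub> g p)"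
        using c c' g A by (intro U.M.finsum_cong') (auto simp: e U.smult_l_distr)
      also have "\<dots> = (\<Oplus>\<^bsub>U\<^esub>p\<in>?A. \<phi> p \<odot>\<^bsub>U\<^esub> g p) \<oplus>\<^bsub>U\<^esub> (\<Oplus>\<^bsub>U\<^esub>p\<in>?A. \<psi> p \<odot>\<^bsub>U\<^esub> g p)"
        using c c' g A by (intro U.M.finsum_addf) auto
      also have "\<dots> = free_eval K U g \<phi> \<oplus>\<^bsub>U\<^esub> free_eval K U g \<psi>"
        by (subst (1 2) free_eval_superset[OF U _ _ A]) (auto simp: g \<phi> \<psi>)
      finally show "free_eval K U g (\<phi> \<oplus>\<^bsub>?F\<^esub> \<psi>) = free_eval K U g \<phi> \<oplus>\<^bsub>U\<^esub> free_eval K U g \<psi>" . }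
    { fix a assume a: "a \<in> carrier K"
      have s: "a \<odot>\<^bsub>?F\<^esub> \<phi> \<in> carrier ?F"
        using vectorspace_free_space[OF K, of S] \<phi> a unfolding vectorspace_def
        by (metis module.smult_closed)
      have e: "(a \<odot>\<^bsub>?F\<^esub> \<phi>) p = a \<otimes>\<^bsub>K\<^esub> \<phi> p" for p by (simp add: free_space_def)
      have "free_eval K U g (a \<odot>\<^bsub>?F\<^esub> \<phi>) = (\<Oplus>\<^bsub>U\<^esub>p\<in>?T. (a \<odot>\<^bsub>?F\<^esub> \<phi>) p \<odot>\<^bsub>U\<^esub> g p)"
        by (rule free_eval_superset[OF U _ s T]) (use a in \<open>auto simp: e g\<close>)
      also have "\<dots> = (\<Oplus>\<^bsub>U\<^esub>p\<in>?T. a \<odot>\<^bsub>U\<^esub> (\<phi> p \<odot>\<^bsub>U\<^esub> g p))"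
        using c g T a by (intro U.M.finsum_cong') (auto simp: e U.smult_assoc1)
      also have "\<dots> = a \<odot>\<^bsub>U\<^esub> free_eval K U g \<phi>"
        unfolding free_eval_def using c g T a by (intro U.finsum_smult[symmetric]) auto
      finally show "free_eval K U g (a \<odot>\<^bsub>?F\<^esub> \<phi>) = a \<odot>\<^bsub>U\<^esub> free_eval K U g \<phi>" . }
  qed
  assume s: "s \<in> S"
  have "free_eval K U g (free_gen K s) = (\<Oplus>\<^bsub>U\<^esub>p\<in>{s}. free_gen K s p \<odot>\<^bsub>U\<^esub> g p)"
    using s g by (intro free_eval_superset[OF U _ free_gen_closed[OF K s]]) (auto simp: free_gen_def)
  then show "free_eval K U g (free_gen K s) = g s"
    using s g by (simp add: free_gen_def)
qed

lemma free_space_linear_eqI: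
  assumes g: "linear_map K (free_space K S) U g" and h: "linear_map K (free_space K S) U h"
    and eq: "\<And>s. s \<in> S \<Longrightarrow> g (free_gen K s) = h (free_gen K s)"
    and \<phi>: "\<phi> \<in> carrier (free_space K S)"
  shows "g \<phi> = h \<phi>"
proof -
  let ?F = "free_space K S"
  interpret F: vectorspace K ?F using g by (rule linear_map_dom)
  have K: "field K" by unfold_locales
  have "g \<phi> = h \<phi>"
    if "finite T" "T \<subseteq> S" "{p. \<phi> p \<noteq> \<zero>\<^bsub>K\<^esub>} \<subseteq> T" "\<phi> \<in> carrier ?F" for T \<phi>
    using that
  proof (induction T arbitrary: \<phi>)
    case empty
    then have "\<phi> = \<zero>\<^bsub>?F\<^esub>" by (auto simp: free_space_def)
    then show ?case using linear_map_zero[OF g] linear_map_zero[OF h] by simp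
  next
    case (insert t T)
    \<comment> \<open>Erasing the coordinate at \<open>t\<close> leaves a function supported in
      \<open>T\<close>, and \<phi> is recovered by adding a multiple of one generator. The induction
      runs over a set that merely contains the support, so this coordinate may already be
      zero.\<close>
    let ?\<psi> = "\<phi>(t := \<zero>\<^bsub>K\<^esub>)"
    have c: "\<phi> t \<in> carrier K" using insert.prems by (auto simp: free_space_def)
    have t: "free_gen K t \<in> carrier ?F" using insert.prems by (intro free_gen_closed K) auto
    have \<psi>: "?\<psi> \<in> carrier ?F"
      using insert.prems
      by (auto simp: free_space_def intro: finite_subset[of _ "{s. \<phi> s \<noteq> \<zero>\<^bsub>K\<^esub>}"])
    have *: "\<phi> = ?\<psi> \<oplus>\<^bsub>?F\<^esub> \<phi> t \<odot>\<^bsub>?F\<^esub> free_gen K t"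
      using insert.prems c by (auto simp: free_space_def free_gen_def fun_eq_iff Pi_iff)
    have "g ?\<psi> = h ?\<psi>"
      using insert.prems by (intro insert.IH \<psi>) auto
    moreover have "g (free_gen K t) = h (free_gen K t)" using insert.prems by (intro eq) auto
    moreover have "k \<phi> = k ?\<psi> \<oplus>\<^bsub>U\<^esub> \<phi> t \<odot>\<^bsub>U\<^esub> k (free_gen K t)" if k: "linear_map K ?F U k" for k
      by (subst *) (simp add: linear_map_add[OF k] linear_map_smult[OF k] \<psi> c t)
    ultimately show ?case by (metis g h)
  qed
  from this[of "{p. \<phi> p \<noteq> \<zero>\<^bsub>K\<^esub>}"] \<phi> show ?thesis by (auto simp: free_space_def)
qed

subsection \<open>Tensor products\<close>

definition bilinear_map ::
  "('k, 'm) ring_scheme \<Rightarrow> ('k, 'v, 'n) module_scheme \<Rightarrow> ('k, 'w, 'o) module_scheme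
    \<Rightarrow> ('k, 'u, 'p) module_scheme \<Rightarrow> ('v \<Rightarrow> 'w \<Rightarrow> 'u) \<Rightarrow> bool" where
  "bilinear_map K V W U \<beta> \<longleftrightarrow>
    (\<forall>w\<in>carrier W. linear_map K V U (\<lambda>v. \<beta> v w)) \<and> (\<forall>v\<in>carrier V. linear_map K W U (\<beta> v))"

lemma bilinear_mapI:
  assumes "\<And>w. w \<in> carrier W \<Longrightarrow> linear_map K V U (\<lambda>v. \<beta> v w)"
    and "\<And>v. v \<in> carrier V \<Longrightarrow> linear_map K W U (\<lambda>w. \<beta> v w)"
  shows "bilinear_map K V W U \<beta>"
  using assms by (simp add: bilinear_map_def)

lemma
  assumes "bilinear_map K V W U \<beta>"
  shows bilinear_map_left: "w \<in> carrier W \<Longrightarrow> linear_map K V U (\<lambda>v. \<beta> v w)"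
    and bilinear_map_right: "v \<in> carrier V \<Longrightarrow> linear_map K W U (\<lambda>w. \<beta> v w)"
  using assms by (simp_all add: bilinear_map_def)

locale tensor_product =
  V: vectorspace K V + W: vectorspace K W
  for K :: "('k, 'm) ring_scheme"
    and V :: "('k, 'v, 'n) module_scheme" and W :: "('k, 'w, 'o) module_scheme"
begin

abbreviation "F \<equiv> free_space K (carrier V \<times> carrier W)"
abbreviation "N \<equiv> tensor_null K V W"
abbreviation "T \<equiv> tensor_space K V W"
abbreviation "\<tau> \<equiv> pure_tensor K V W"
abbreviation "\<pi> \<phi> \<equiv> N +>\<^bsub>F\<^esub> \<phi>"

lemma field_K: "field K"
  by unfold_locales

sublocale F: vectorspace K F
  by (rule vectorspace_free_space[OF field_K])

lemma gen: "v \<in> carrier V \<Longrightarrow> w \<in> carrier W \<Longrightarrow> free_gen K (v, w) \<in> carrier F"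
  by (rule free_gen_closed[OF field_K]) simp

lemma relations_subset: "bilinear_relations K V W \<subseteq> carrier F"
  unfolding bilinear_relations_def Let_def
  by (auto intro!: F.M.minus_closed F.M.a_closed F.smult_closed gen)

lemma relationsI:
  assumes "v \<in> carrier V" "w \<in> carrier W"
  shows "v' \<in> carrier V \<Longrightarrow>
      free_gen K (v \<oplus>\<^bsub>V\<^esub> v', w) \<ominus>\<^bsub>F\<^esub> (free_gen K (v, w) \<oplus>\<^bsub>F\<^esub> free_gen K (v', w))
        \<in> bilinear_relations K V W"
    and "w' \<in> carrier W \<Longrightarrow>
      free_gen K (v, w \<oplus>\<^bsub>W\<^esub> w') \<ominus>\<^bsub>F\<^esub> (free_gen K (v, w) \<oplus>\<^bsub>F\<^esub> free_gen K (v, w'))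
        \<in> bilinear_relations K V W"
    and "a \<in> carrier K \<Longrightarrow>
      free_gen K (a \<odot>\<^bsub>V\<^esub> v, w) \<ominus>\<^bsub>F\<^esub> (a \<odot>\<^bsub>F\<^esub> free_gen K (v, w)) \<in> bilinear_relations K V W"
    and "a \<in> carrier K \<Longrightarrow>
      free_gen K (v, a \<odot>\<^bsub>W\<^esub> w) \<ominus>\<^bsub>F\<^esub> (a \<odot>\<^bsub>F\<^esub> free_gen K (v, w)) \<in> bilinear_relations K V W"
  unfolding bilinear_relations_def Let_def using assms by blast+

lemma submodule_null: "submodule K N F"
  unfolding tensor_null_def by (rule F.span_is_submodule[OF relations_subset])

lemma relations_null: "r \<in> bilinear_relations K V W \<Longrightarrow> r \<in> N"
  unfolding tensor_null_def using F.in_own_span[OF relations_subset] by auto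

lemma tensor_space_quotient: "T = quotient_space F N"
  by (simp add: tensor_space_def quotient_space_def Let_def)

lemma linear_projection: "linear_map K F T (\<lambda>\<phi>. \<pi> \<phi>)"
  unfolding tensor_space_quotient
  by (rule quotient_space_projection(1)[OF F.vectorspace_axioms submodule_null])

lemma vectorspace_T: "vectorspace K T"
  using linear_projection by (rule linear_map_cod)

lemma mem_projection:
  "\<phi> \<in> carrier F \<Longrightarrow> \<psi> \<in> \<pi> \<phi> \<longleftrightarrow> \<psi> \<in> carrier F \<and> \<psi> \<ominus>\<^bsub>F\<^esub> \<phi> \<in> N"
  by (rule quotient_space_projection(3)[OF F.vectorspace_axioms submodule_null])

lemma carrier_T: "carrier T = (\<lambda>\<phi>. \<pi> \<phi>) ` carrier F"
  unfolding tensor_space_quotient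
  by (rule quotient_space_projection(4)[OF F.vectorspace_axioms submodule_null])

lemma projection_eq:
  assumes "\<phi> \<in> carrier F" "\<psi> \<in> carrier F" "\<phi> \<ominus>\<^bsub>F\<^esub> \<psi> \<in> bilinear_relations K V W"
  shows "\<pi> \<phi> = \<pi> \<psi>"
proof -
  interpret T: vectorspace K T by (rule vectorspace_T)
  interpret P: linear_map K F T "\<lambda>\<phi>. \<pi> \<phi>" by (rule linear_projection)
  have "\<pi> (\<phi> \<ominus>\<^bsub>F\<^esub> \<psi>) = \<zero>\<^bsub>T\<^esub>"
    using quotient_space_projection(2)[OF F.vectorspace_axioms submodule_null relations_null[OF assms(3)]]
    by (simp add: tensor_space_def Let_def)
  then have "\<pi> \<phi> \<ominus>\<^bsub>T\<^esub> \<pi> \<psi> = \<zero>\<^bsub>T\<^esub>" using assms by simp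
  then show ?thesis using assms by (simp add: P.f_im)
qed

text \<open>Each of the four families of \<open>bilinear_relations\<close> lies in the null space
  and becomes one of the four laws in the quotient.\<close>

lemma pure_bilinear: "bilinear_map K V W T \<tau>"
proof (rule bilinear_mapI)
  fix w assume w: "w \<in> carrier W"
  show "linear_map K V T (\<lambda>v. \<tau> v w)"
  proof (rule linear_mapI[OF V.vectorspace_axioms vectorspace_T])
    fix v assume v: "v \<in> carrier V"
    show "\<tau> v w \<in> carrier T"
      using gen[OF v w] by (simp add: carrier_T pure_tensor_def)
    { fix v' assume v': "v' \<in> carrier V"
      have "\<pi> (free_gen K (v \<oplus>\<^bsub>V\<^esub> v', w)) = \<pi> (free_gen K (v, w) \<oplus>\<^bsub>F\<^esub> free_gen K (v', w))"
        using v v' w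
        by (intro projection_eq gen F.M.a_closed) (auto intro: relationsI)
      then show "\<tau> (v \<oplus>\<^bsub>V\<^esub> v') w = \<tau> v w \<oplus>\<^bsub>T\<^esub> \<tau> v' w"
        using v v' w by (simp add: pure_tensor_def linear_map_add[OF linear_projection] gen) }
    { fix a assume a: "a \<in> carrier K"
      have "\<pi> (free_gen K (a \<odot>\<^bsub>V\<^esub> v, w)) = \<pi> (a \<odot>\<^bsub>F\<^esub> free_gen K (v, w))"
        using v a w
        by (intro projection_eq gen F.smult_closed) (auto intro: relationsI)
      then show "\<tau> (a \<odot>\<^bsub>V\<^esub> v) w = a \<odot>\<^bsub>T\<^esub> \<tau> v w"
        using v a w by (simp add: pure_tensor_def linear_map_smult[OF linear_projection] gen) }
  qed
next
  fix v assume v: "v \<in> carrier V"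
  show "linear_map K W T (\<lambda>w. \<tau> v w)"
  proof (rule linear_mapI[OF W.vectorspace_axioms vectorspace_T])
    fix w assume w: "w \<in> carrier W"
    show "\<tau> v w \<in> carrier T"
      using gen[OF v w] by (simp add: carrier_T pure_tensor_def)
    { fix w' assume w': "w' \<in> carrier W"
      have "\<pi> (free_gen K (v, w \<oplus>\<^bsub>W\<^esub> w')) = \<pi> (free_gen K (v, w) \<oplus>\<^bsub>F\<^esub> free_gen K (v, w'))"
        using v w' w
        by (intro projection_eq gen F.M.a_closed) (auto intro: relationsI)
      then show "\<tau> v (w \<oplus>\<^bsub>W\<^esub> w') = \<tau> v w \<oplus>\<^bsub>T\<^esub> \<tau> v w'"
        using v w' w by (simp add: pure_tensor_def linear_map_add[OF linear_projection] gen) }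
    { fix a assume a: "a \<in> carrier K"
      have "\<pi> (free_gen K (v, a \<odot>\<^bsub>W\<^esub> w)) = \<pi> (a \<odot>\<^bsub>F\<^esub> free_gen K (v, w))"
        using v a w
        by (intro projection_eq gen F.smult_closed) (auto intro: relationsI)
      then show "\<tau> v (a \<odot>\<^bsub>W\<^esub> w) = a \<odot>\<^bsub>T\<^esub> \<tau> v w"
        using v a w by (simp add: pure_tensor_def linear_map_smult[OF linear_projection] gen) }
  qed
qed

text \<open>Pulled back along the surjective projection, both maps agree on the generators of the
  free space. Nearly all later identities between maps on tensor products reduce to pure tensors
  through this lemma.\<close>

lemma linear_eqI:
  assumes g: "linear_map K T U g" and h: "linear_map K T U h"
    and eq: "\<And>v w. v \<in> carrier V \<Longrightarrow> w \<in> carrier W \<Longrightarrow> g (\<tau> v w) = h (\<tau> v w)"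
    and t: "t \<in> carrier T"
  shows "g t = h t"
proof -
  obtain \<phi> where \<phi>: "\<phi> \<in> carrier F" "t = \<pi> \<phi>" using t by (auto simp: carrier_T)
  have "g (\<pi> \<phi>) = h (\<pi> \<phi>)"
    by (rule free_space_linear_eqI[OF linear_map_comp[OF linear_projection g]
          linear_map_comp[OF linear_projection h] _ \<phi>(1)])
       (use eq in \<open>auto simp: pure_tensor_def\<close>)
  then show ?thesis by (simp add: \<phi>)
qed

context
  fixes U :: "('k, 'u, 'p) module_scheme" and \<beta>
  assumes U: "vectorspace K U" and \<beta>: "bilinear_map K V W U \<beta>"
begin

text \<open>\<open>tensor_lift\<close> picks an unknown representative of the coset. It differs from
  \<phi> by an element of \<open>N\<close>, and \<open>N\<close> lies in the kernel of the linear
  extension, since bilinearity of \<beta> kills every relation. Hence the choice does not matter and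
  the lift is the map induced on the quotient.\<close>

lemma lift_projection:
  assumes \<phi>: "\<phi> \<in> carrier F"
  shows "tensor_lift K U \<beta> (\<pi> \<phi>) = free_eval K U (\<lambda>p. \<beta> (fst p) (snd p)) \<phi>"
proof -
  let ?b = "\<lambda>p. \<beta> (fst p) (snd p)"
  let ?e = "free_eval K U ?b"
  note l = bilinear_map_left[OF \<beta>] and r = bilinear_map_right[OF \<beta>]
  interpret U: vectorspace K U by (rule U)
  have b: "?b p \<in> carrier U" if "p \<in> carrier V \<times> carrier W" for p
    using that linear_map_closed[OF l, of "snd p" "fst p"] by auto
  have e: "linear_map K F U ?e" by (rule linear_map_free_eval[OF U]) (rule b)
  interpret e: linear_map K F U ?e by (rule e)
  have eg: "?e (free_gen K (v, w)) = \<beta> v w" if "v \<in> carrier V" "w \<in> carrier W" for v w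
    using free_eval_gen[OF U b, where s = "(v, w)"] that by simp
  have bc: "\<beta> v w \<in> carrier U" if "v \<in> carrier V" "w \<in> carrier W" for v w
    using b[of "(v, w)"] that by simp
  have "bilinear_relations K V W \<subseteq> e.ker"
    unfolding bilinear_relations_def Let_def e.ker_def
    by (auto intro!: F.M.minus_closed F.M.a_closed F.smult_closed
          simp: gen eg bc U.M.r_neg a_minus_def
            linear_map_add[OF l] linear_map_add[OF r] linear_map_smult[OF l] linear_map_smult[OF r])
  then have "N \<subseteq> e.ker"
    unfolding tensor_null_def by (rule F.span_is_subset[OF _ e.ker_is_submodule])
  moreover define \<psi> where "\<psi> = (SOME \<psi>. \<psi> \<in> \<pi> \<phi>)"
  have "\<phi> \<in> \<pi> \<phi>"
    using \<phi> submodule_null by (simp add: mem_projection F.M.r_neg a_minus_def submodule_def)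
  then have "\<psi> \<in> \<pi> \<phi>" unfolding \<psi>_def by (rule someI[of "\<lambda>\<psi>. \<psi> \<in> \<pi> \<phi>"])
  then have \<psi>: "\<psi> \<in> carrier F" "\<psi> \<ominus>\<^bsub>F\<^esub> \<phi> \<in> N" using \<phi> by (simp_all add: mem_projection)
  ultimately have "?e (\<psi> \<ominus>\<^bsub>F\<^esub> \<phi>) = \<zero>\<^bsub>U\<^esub>" by (auto simp: e.ker_def)
  then have "?e \<psi> = ?e \<phi>" using \<phi> \<psi> by (simp add: e.f_im)
  then show ?thesis
    by (simp add: tensor_lift_def free_eval_def \<psi>_def Let_def)
qed

lemma linear_map_lift: "linear_map K T U (tensor_lift K U \<beta>)"
proof -
  let ?e = "free_eval K U (\<lambda>p. \<beta> (fst p) (snd p))"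
  have e: "linear_map K F U ?e"
    by (rule linear_map_free_eval[OF U])
       (use linear_map_closed[OF bilinear_map_left[OF \<beta>]] in auto)
  note P = linear_projection
  show ?thesis
  proof (rule linear_mapI[OF vectorspace_T U])
    fix s t assume "s \<in> carrier T"
    then obtain \<phi> where \<phi>: "\<phi> \<in> carrier F" "s = \<pi> \<phi>" by (auto simp: carrier_T)
    show "tensor_lift K U \<beta> s \<in> carrier U"
      using \<phi> by (simp add: lift_projection linear_map_closed[OF e])
    { fix a assume a: "a \<in> carrier K"
      then show "tensor_lift K U \<beta> (a \<odot>\<^bsub>T\<^esub> s) = a \<odot>\<^bsub>U\<^esub> tensor_lift K U \<beta> s"
        using \<phi> linear_map_smult[OF P, symmetric]
        by (simp add: lift_projection linear_map_smult[OF e] F.smult_closed) }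
    assume "t \<in> carrier T"
    then obtain \<psi> where \<psi>: "\<psi> \<in> carrier F" "t = \<pi> \<psi>" by (auto simp: carrier_T)
    then show "tensor_lift K U \<beta> (s \<oplus>\<^bsub>T\<^esub> t) = tensor_lift K U \<beta> s \<oplus>\<^bsub>U\<^esub> tensor_lift K U \<beta> t"
      using \<phi> linear_map_add[OF P, symmetric]
      by (simp add: lift_projection linear_map_add[OF e] F.M.a_closed)
  qed
qed

lemma lift_pure:
  assumes "v \<in> carrier V" "w \<in> carrier W"
  shows "tensor_lift K U \<beta> (\<tau> v w) = \<beta> v w"
  using assms lift_projection[OF gen] free_eval_gen[OF U, where s = "(v, w)" and S = "carrier V \<times> carrier W" and g = "\<lambda>p. \<beta> (fst p) (snd p)"]
    linear_map_closed[OF bilinear_map_left[OF \<beta>]]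
  by (auto simp: pure_tensor_def)

end

end

lemma tensor_productI:
  "vectorspace K V \<Longrightarrow> vectorspace K W \<Longrightarrow> tensor_product K V W"
  by (rule tensor_product.intro)

lemmas vectorspace_tensor = tensor_product.vectorspace_T[OF tensor_productI]
lemmas pure_tensor_bilinear = tensor_product.pure_bilinear[OF tensor_productI]
lemmas tensor_eqI = tensor_product.linear_eqI[OF tensor_productI]
lemmas linear_map_tensor_lift = tensor_product.linear_map_lift[OF tensor_productI]
lemmas tensor_lift_pure = tensor_product.lift_pure[OF tensor_productI]

lemma pure_tensor_closed:
  assumes "vectorspace K V" "vectorspace K W" "v \<in> carrier V" "w \<in> carrier W"
  shows "pure_tensor K V W v w \<in> carrier (tensor_space K V W)"
  by (rule linear_map_closed[OF bilinear_map_left[OF pure_tensor_bilinear]]) (use assms in auto)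

section \<open>Functoriality of the tensor product\<close>

lemma bilinear_tensor_map:
  assumes g: "linear_map K V V' g" and h: "linear_map K W W' h"
  shows "bilinear_map K V W (tensor_space K V' W') (\<lambda>v w. pure_tensor K V' W' (g v) (h w))"
proof -
  note P = pure_tensor_bilinear[OF linear_map_cod[OF g] linear_map_cod[OF h]]
  show ?thesis
    by (intro bilinear_mapI linear_map_comp[OF g bilinear_map_left[OF P]]
          linear_map_comp[OF h bilinear_map_right[OF P]]
          linear_map_closed[OF g] linear_map_closed[OF h])
qed

lemma linear_map_tensor_map:
  assumes g: "linear_map K V V' g" and h: "linear_map K W W' h"
  shows "linear_map K (tensor_space K V W) (tensor_space K V' W') (tensor_map K V' W' g h)"
  unfolding tensor_map_def
  using linear_map_dom[OF g] linear_map_dom[OF h] linear_map_cod[OF g] linear_map_cod[OF h]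
  by (intro linear_map_tensor_lift bilinear_tensor_map[OF g h] vectorspace_tensor)

lemma tensor_map_pure:
  assumes g: "linear_map K V V' g" and h: "linear_map K W W' h"
    and "v \<in> carrier V" "w \<in> carrier W"
  shows "tensor_map K V' W' g h (pure_tensor K V W v w) = pure_tensor K V' W' (g v) (h w)"
  unfolding tensor_map_def
  using linear_map_dom[OF g] linear_map_dom[OF h] linear_map_cod[OF g] linear_map_cod[OF h] assms
  by (intro tensor_lift_pure bilinear_tensor_map[OF g h] vectorspace_tensor)

lemma tensor_map_comp:
  assumes g: "linear_map K V V' g" and h: "linear_map K W W' h"
    and g': "linear_map K V' V'' g'" and h': "linear_map K W' W'' h'"
    and t: "t \<in> carrier (tensor_space K V W)"
  shows "tensor_map K V'' W'' g' h' (tensor_map K V' W' g h t) =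
    tensor_map K V'' W'' (\<lambda>v. g' (g v)) (\<lambda>w. h' (h w)) t"
proof (rule tensor_eqI[OF linear_map_dom[OF g] linear_map_dom[OF h]
      linear_map_comp[OF linear_map_tensor_map[OF g h] linear_map_tensor_map[OF g' h']] _ _ t])
  note gg = linear_map_comp[OF g g'] and hh = linear_map_comp[OF h h']
  show "linear_map K (tensor_space K V W) (tensor_space K V'' W'')
      (tensor_map K V'' W'' (\<lambda>v. g' (g v)) (\<lambda>w. h' (h w)))"
    by (rule linear_map_tensor_map[OF gg hh])
  fix v w assume "v \<in> carrier V" "w \<in> carrier W"
  then show "tensor_map K V'' W'' g' h' (tensor_map K V' W' g h (pure_tensor K V W v w)) =
      tensor_map K V'' W'' (\<lambda>v. g' (g v)) (\<lambda>w. h' (h w)) (pure_tensor K V W v w)"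
    by (simp add: tensor_map_pure[OF g h] tensor_map_pure[OF g' h'] tensor_map_pure[OF gg hh]
          linear_map_closed[OF g] linear_map_closed[OF h])
qed

text \<open>\<open>tensor_map\<close> receives total functions; their values outside the carriers
  have no influence. This permits exchanging restricted and unrestricted versions of a map, and
  using equations that hold on carriers only.\<close>

lemma tensor_map_cong:
  assumes g: "linear_map K V V' g" and h: "linear_map K W W' h"
    and g': "\<And>v. v \<in> carrier V \<Longrightarrow> g' v = g v" and h': "\<And>w. w \<in> carrier W \<Longrightarrow> h' w = h w"
    and t: "t \<in> carrier (tensor_space K V W)"
  shows "tensor_map K V' W' g' h' t = tensor_map K V' W' g h t"
proof -
  note G = linear_map_cong[OF g g'] and H = linear_map_cong[OF h h']
  show ?thesis
    by (rule tensor_eqI[OF linear_map_dom[OF g] linear_map_dom[OF h]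
          linear_map_tensor_map[OF G H] linear_map_tensor_map[OF g h] _ t])
       (simp_all add: tensor_map_pure[OF g h] tensor_map_pure[OF G H] g' h')
qed

lemma tensor_map_id:
  assumes V: "vectorspace K V" and W: "vectorspace K W"
    and t: "t \<in> carrier (tensor_space K V W)"
  shows "tensor_map K V W (\<lambda>v. v) (\<lambda>w. w) t = t"
  by (rule tensor_eqI[OF V W linear_map_tensor_map[OF linear_map_id[OF V] linear_map_id[OF W]]
        linear_map_id[OF vectorspace_tensor[OF V W]] _ t])
     (simp add: tensor_map_pure[OF linear_map_id[OF V] linear_map_id[OF W]])

lemma tensor_map_closed:
  assumes "linear_map K V V' g" "linear_map K W W' h" "t \<in> carrier (tensor_space K V W)"
  shows "tensor_map K V' W' g h t \<in> carrier (tensor_space K V' W')"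
  by (rule linear_map_closed[OF linear_map_tensor_map[OF assms(1,2)] assms(3)])

section \<open>The associator and its naturality\<close>

context
  fixes K :: "('k, 'm) ring_scheme" and U :: "('k, 'u, 'n) module_scheme"
    and V :: "('k, 'v, 'o) module_scheme" and W :: "('k, 'w, 'p) module_scheme"
  assumes U: "vectorspace K U" and V: "vectorspace K V" and W: "vectorspace K W"
begin

private abbreviation "UV \<equiv> tensor_space K U V"
private abbreviation "VW \<equiv> tensor_space K V W"
private abbreviation "U_VW \<equiv> tensor_space K U VW"
private abbreviation "\<beta> w u v \<equiv> pure_tensor K U VW u (pure_tensor K V W v w)"

private lemma UV: "vectorspace K UV" and VW: "vectorspace K VW" and U_VW: "vectorspace K U_VW"
  by (intro vectorspace_tensor U V W)+

private lemma bilinear_inner: "w \<in> carrier W \<Longrightarrow> bilinear_map K U V U_VW (\<beta> w)"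
  by (intro bilinear_mapI bilinear_map_left[OF pure_tensor_bilinear[OF U VW]]
      linear_map_comp[OF bilinear_map_left[OF pure_tensor_bilinear[OF V W]]
        bilinear_map_right[OF pure_tensor_bilinear[OF U VW]]] pure_tensor_closed V W)

text \<open>Linearity in \<open>t\<close> is that of a lift. For linearity in \<open>w\<close> the
  element \<open>t\<close> is arbitrary and has no formula; but both sides of each law are linear in
  \<open>t\<close>, so it is enough to compare them on pure tensors, where the inner lift
  evaluates.\<close>

private lemma bilinear_outer:
  "bilinear_map K UV W U_VW (\<lambda>t w. tensor_lift K U_VW (\<beta> w) t)"
proof (rule bilinear_mapI)
  note L = linear_map_tensor_lift[OF U V U_VW bilinear_inner]
  note lp = tensor_lift_pure[OF U V U_VW bilinear_inner]
  show "linear_map K UV U_VW (tensor_lift K U_VW (\<beta> w))" if "w \<in> carrier W" for w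
    using that by (rule L)
  fix t assume t: "t \<in> carrier UV"
  interpret W: vectorspace K W by (rule W)
  have lin: "linear_map K W U_VW (\<lambda>w. \<beta> w u v)" if "u \<in> carrier U" "v \<in> carrier V" for u v
    by (intro linear_map_comp[OF bilinear_map_right[OF pure_tensor_bilinear[OF V W]]
          bilinear_map_right[OF pure_tensor_bilinear[OF U VW]]] that)
  show "linear_map K W U_VW (\<lambda>w. tensor_lift K U_VW (\<beta> w) t)"
  proof (rule linear_mapI[OF W U_VW])
    fix w assume w: "w \<in> carrier W"
    show "tensor_lift K U_VW (\<beta> w) t \<in> carrier U_VW"
      using w t by (intro linear_map_closed[OF L])
    show "tensor_lift K U_VW (\<beta> (w \<oplus>\<^bsub>W\<^esub> w')) t =
        tensor_lift K U_VW (\<beta> w) t \<oplus>\<^bsub>U_VW\<^esub> tensor_lift K U_VW (\<beta> w') t"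
      if w': "w' \<in> carrier W" for w'
      by (rule tensor_eqI[OF U V L linear_map_sum[OF L L] _ t])
         (use w w' in \<open>simp_all add: lp linear_map_add[OF lin]\<close>)
    show "tensor_lift K U_VW (\<beta> (a \<odot>\<^bsub>W\<^esub> w)) t = a \<odot>\<^bsub>U_VW\<^esub> tensor_lift K U_VW (\<beta> w) t"
      if a: "a \<in> carrier K" for a
      by (rule tensor_eqI[OF U V L linear_map_scale[OF L] _ t])
         (use w a in \<open>simp_all add: lp linear_map_smult[OF lin]\<close>)
  qed
qed

lemma linear_map_tensor_assoc:
  "linear_map K (tensor_space K (tensor_space K U V) W) (tensor_space K U (tensor_space K V W))
    (tensor_assoc K U V W)"
  unfolding tensor_assoc_def Let_def
  by (rule linear_map_tensor_lift[OF UV W U_VW bilinear_outer])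

lemma tensor_assoc_pure:
  assumes "u \<in> carrier U" "v \<in> carrier V" "w \<in> carrier W"
  shows "tensor_assoc K U V W (pure_tensor K (tensor_space K U V) W (pure_tensor K U V u v) w) =
    pure_tensor K U (tensor_space K V W) u (pure_tensor K V W v w)"
  unfolding tensor_assoc_def Let_def
  using assms
  by (simp add: tensor_lift_pure[OF UV W U_VW bilinear_outer] pure_tensor_closed U V
      tensor_lift_pure[OF U V U_VW bilinear_inner])

text \<open>The reduction to pure tensors, applied first to the outer product and then, with
  \<open>w\<close> fixed, to the inner one.\<close>

lemma tensor_eqI3:
  assumes g: "linear_map K (tensor_space K (tensor_space K U V) W) Z g"
    and h: "linear_map K (tensor_space K (tensor_space K U V) W) Z h"
    and eq: "\<And>u v w. u \<in> carrier U \<Longrightarrow> v \<in> carrier V \<Longrightarrow> w \<in> carrier W \<Longrightarrow>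
      g (pure_tensor K (tensor_space K U V) W (pure_tensor K U V u v) w) =
      h (pure_tensor K (tensor_space K U V) W (pure_tensor K U V u v) w)"
    and t: "t \<in> carrier (tensor_space K (tensor_space K U V) W)"
  shows "g t = h t"
proof (rule tensor_eqI[OF UV W g h _ t])
  fix s w assume s: "s \<in> carrier UV" and w: "w \<in> carrier W"
  note P = bilinear_map_left[OF pure_tensor_bilinear[OF UV W] w]
  show "g (pure_tensor K UV W s w) = h (pure_tensor K UV W s w)"
    by (rule tensor_eqI[OF U V linear_map_comp[OF P g] linear_map_comp[OF P h] _ s])
       (use eq w in auto)
qed

end

lemma tensor_assoc_natural:
  assumes g: "linear_map K U U' g" and h: "linear_map K V V' h" and k: "linear_map K W W' k"
    and t: "t \<in> carrier (tensor_space K (tensor_space K U V) W)"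
  shows "tensor_assoc K U' V' W' (tensor_map K (tensor_space K U' V') W' (tensor_map K U' V' g h) k t) =
    tensor_map K U' (tensor_space K V' W') g (tensor_map K V' W' h k) (tensor_assoc K U V W t)"
proof -
  note dom = linear_map_dom[OF g] linear_map_dom[OF h] linear_map_dom[OF k]
  note cod = linear_map_cod[OF g] linear_map_cod[OF h] linear_map_cod[OF k]
  note gh = linear_map_tensor_map[OF g h] and hk = linear_map_tensor_map[OF h k]
  show ?thesis
    by (rule tensor_eqI3[OF dom linear_map_comp[OF linear_map_tensor_map[OF gh k] linear_map_tensor_assoc[OF cod]]
          linear_map_comp[OF linear_map_tensor_assoc[OF dom] linear_map_tensor_map[OF g hk]] _ t])
       (simp add: tensor_map_pure[OF gh k] tensor_map_pure[OF g h] tensor_map_pure[OF h k] tensor_map_pure[OF g hk]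
          tensor_assoc_pure dom cod pure_tensor_closed
          linear_map_closed[OF g] linear_map_closed[OF h] linear_map_closed[OF k])
qed

section \<open>The ground field as a tensor factor, and retracts of tensor products\<close>

lemma vectorspace_base_space:
  assumes "field K"
  shows "vectorspace K (base_space K)"
proof -
  interpret K: field K by fact
  show ?thesis
    by (rule vs_criteria)
       (auto simp: base_space_def K.a_ac K.m_assoc K.l_distr K.r_distr assms
          intro!: bexI[of _ "\<ominus>\<^bsub>K\<^esub> _"] K.r_neg)
qed

text \<open>Scalar multiplication is bilinear, so it induces a linear map from K \<otimes> V to
  \<open>V\<close> that takes 1 \<otimes> v back to \<open>v\<close>.\<close>

lemma base_space_tensor_cancel:
  assumes V: "vectorspace K V" and v: "v \<in> carrier V"
    and eq: "pure_tensor K (base_space K) V \<one>\<^bsub>K\<^esub> v = \<zero>\<^bsub>tensor_space K (base_space K) V\<^esub>"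
  shows "v = \<zero>\<^bsub>V\<^esub>"
proof -
  interpret V: vectorspace K V by (rule V)
  have K: "field K" by unfold_locales
  note B = vectorspace_base_space[OF K]
  have b: "bilinear_map K (base_space K) V V (smult V)"
  proof (rule bilinear_mapI)
    show "linear_map K (base_space K) V (\<lambda>a. a \<odot>\<^bsub>V\<^esub> w)" if "w \<in> carrier V" for w
      by (rule linear_mapI[OF B V])
         (use that in \<open>auto simp: base_space_def V.smult_l_distr V.smult_assoc1\<close>)
    show "linear_map K V V (smult V a)" if "a \<in> carrier (base_space K)" for a
      using linear_map_scale[OF linear_map_id[OF V], of a] that by (simp add: base_space_def)
  qed
  have "tensor_lift K V (smult V) (pure_tensor K (base_space K) V \<one>\<^bsub>K\<^esub> v) = \<one>\<^bsub>K\<^esub> \<odot>\<^bsub>V\<^esub> v"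
    by (rule tensor_lift_pure[OF B V V b]) (auto simp: base_space_def v)
  then show ?thesis
    using v linear_map_zero[OF linear_map_tensor_lift[OF B V V b]] by (simp add: eq)
qed

text \<open>By functoriality a pair of left inverses tensors to a left inverse. Injectivity of id
  \<otimes> f and of i \<otimes> id is always obtained in this way.\<close>

lemma tensor_map_retract:
  assumes g: "linear_map K V V' g" and h: "linear_map K W W' h"
    and g': "linear_map K V' V g'" and h': "linear_map K W' W h'"
    and "\<And>v. v \<in> carrier V \<Longrightarrow> g' (g v) = v" "\<And>w. w \<in> carrier W \<Longrightarrow> h' (h w) = w"
    and t: "t \<in> carrier (tensor_space K V W)"
  shows "tensor_map K V W g' h' (tensor_map K V' W' g h t) = t"
proof -
  note V = linear_map_dom[OF g] and W = linear_map_dom[OF h]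
  have "tensor_map K V W g' h' (tensor_map K V' W' g h t) =
      tensor_map K V W (\<lambda>v. g' (g v)) (\<lambda>w. h' (h w)) t"
    by (rule tensor_map_comp[OF g h g' h' t])
  also have "\<dots> = tensor_map K V W (\<lambda>v. v) (\<lambda>w. w) t"
    by (rule tensor_map_cong[OF linear_map_id[OF V] linear_map_id[OF W] _ _ t]) (use assms in auto)
  also have "\<dots> = t" by (rule tensor_map_id[OF V W t])
  finally show ?thesis .
qed

text \<open>Shaped for the kernel projection id - s \<eta>, which is the case of scalar -1.\<close>

lemma tensor_map_add_scale_left:
  assumes g: "linear_map K V V' g" and g': "linear_map K V V' g'" and h: "linear_map K W W' h"
    and a: "a \<in> carrier K" and t: "t \<in> carrier (tensor_space K V W)"
  shows "tensor_map K V' W' (\<lambda>v. g v \<oplus>\<^bsub>V'\<^esub> a \<odot>\<^bsub>V'\<^esub> g' v) h t =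
    tensor_map K V' W' g h t \<oplus>\<^bsub>tensor_space K V' W'\<^esub>
      a \<odot>\<^bsub>tensor_space K V' W'\<^esub> tensor_map K V' W' g' h t"
proof -
  note G = linear_map_sum[OF g linear_map_scale[OF g' a]]
  interpret V': vectorspace K V' using g by (rule linear_map_cod)
  show ?thesis
  proof (rule tensor_eqI[OF linear_map_dom[OF g] linear_map_dom[OF h] linear_map_tensor_map[OF G h]
        linear_map_sum[OF linear_map_tensor_map[OF g h]
          linear_map_scale[OF linear_map_tensor_map[OF g' h] a]] _ t])
    fix v w assume v: "v \<in> carrier V" and w: "w \<in> carrier W"
    note P = bilinear_map_left[OF pure_tensor_bilinear[OF linear_map_cod[OF g] linear_map_cod[OF h]]
        linear_map_closed[OF h w]]
    show "tensor_map K V' W' (\<lambda>v. g v \<oplus>\<^bsub>V'\<^esub> a \<odot>\<^bsub>V'\<^esub> g' v) h (pure_tensor K V W v w) =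
        tensor_map K V' W' g h (pure_tensor K V W v w) \<oplus>\<^bsub>tensor_space K V' W'\<^esub>
        a \<odot>\<^bsub>tensor_space K V' W'\<^esub> tensor_map K V' W' g' h (pure_tensor K V W v w)"
      using v w a
      by (simp add: tensor_map_pure[OF G h] tensor_map_pure[OF g h] tensor_map_pure[OF g' h]
          linear_map_add[OF P] linear_map_smult[OF P] linear_map_closed[OF g] linear_map_closed[OF g'])
  qed
qed

lemma linear_map_const_zero:
  assumes "vectorspace K V" "vectorspace K W"
  shows "linear_map K V W (\<lambda>_. \<zero>\<^bsub>W\<^esub>)"
proof -
  interpret W: vectorspace K W by fact
  show ?thesis by (rule linear_mapI[OF assms]) auto
qed

lemma tensor_map_zero_left:
  assumes V: "vectorspace K V" and V': "vectorspace K V'" and h: "linear_map K W W' h"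
    and t: "t \<in> carrier (tensor_space K V W)"
  shows "tensor_map K V' W' (\<lambda>_. \<zero>\<^bsub>V'\<^esub>) h t = \<zero>\<^bsub>tensor_space K V' W'\<^esub>"
proof -
  note W = linear_map_dom[OF h] and W' = linear_map_cod[OF h]
  note Z = linear_map_const_zero[OF V V']
  show ?thesis
    by (rule tensor_eqI[OF V W linear_map_tensor_map[OF Z h]
          linear_map_const_zero[OF vectorspace_tensor[OF V W] vectorspace_tensor[OF V' W']] _ t])
       (simp add: tensor_map_pure[OF Z h] linear_map_closed[OF h]
          linear_map_zero[OF bilinear_map_left[OF pure_tensor_bilinear[OF V' W']]])
qed

text \<open>Only these record fields enter the tensor constructions, so comodules that differ in the
  remaining fields (or in the type of the extension) have literally equal tensor products.\<close>

definition same_space :: "('k, 'v, 'n) module_scheme \<Rightarrow> ('k, 'v, 'o) module_scheme \<Rightarrow> bool" where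
  "same_space V V' \<longleftrightarrow>
    carrier V = carrier V' \<and> add V = add V' \<and> zero V = zero V' \<and> smult V = smult V'"

lemma same_space_sym: "same_space V V' \<Longrightarrow> same_space V' V"
  by (simp add: same_space_def)

lemma
  assumes "same_space V V'"
  shows same_space_carrier: "carrier V = carrier V'"
    and same_space_linear_id: "vectorspace K V \<Longrightarrow> linear_map K V V' (\<lambda>v. v)"
    and same_space_tensor_space: "tensor_space K V W = tensor_space K V' W"
    and same_space_pure_tensor: "pure_tensor K V W = pure_tensor K V' W"
proof -
  show "carrier V = carrier V'" using assms by (simp add: same_space_def)
  show "vectorspace K V \<Longrightarrow> linear_map K V V' (\<lambda>v. v)"
    using assms by (intro vectorspace_surj_image) (simp_all add: same_space_def)
  show "tensor_space K V W = tensor_space K V' W"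
    using assms by (simp add: same_space_def tensor_space_def tensor_null_def bilinear_relations_def)
  show "pure_tensor K V W = pure_tensor K V' W"
    using assms
    by (simp add: fun_eq_iff same_space_def pure_tensor_def tensor_null_def bilinear_relations_def)
qed

lemma same_space_vectorspace: "same_space V V' \<Longrightarrow> vectorspace K V \<longleftrightarrow> vectorspace K V'"
  using same_space_linear_id same_space_sym linear_map_cod by metis

lemma
  assumes "same_space V V'"
  shows same_space_tensor_map: "tensor_map K V W g h = tensor_map K V' W g h"
    and same_space_tensor_assoc: "tensor_assoc K V W U = tensor_assoc K V' W U"
  using assms
  by (simp_all add: fun_eq_iff tensor_map_def tensor_assoc_def same_space_tensor_space[OF assms]
        same_space_pure_tensor[OF assms])

lemma same_space_linear_map:
  assumes "same_space V V'"
  shows "linear_map K V W g \<longleftrightarrow> linear_map K V' W g" "linear_map K U V h \<longleftrightarrow> linear_map K U V' h"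
  unfolding linear_map_iff same_space_vectorspace[OF assms]
  using assms by (simp_all add: module_hom_def same_space_def)

subsection \<open>Coactions\<close>

text \<open>The comodule axioms for a bare space and a bare map, without the record and without
  extensionality. Composites of maps, the regular coaction on \<open>C\<close> and spaces that are
  not comodule records can then be treated uniformly.\<close>

definition coaction ::
  "('k, 'm) ring_scheme \<Rightarrow> ('k, 'c, 'n) coalgebra_scheme \<Rightarrow> ('k, 'v, 'o) module_scheme
    \<Rightarrow> ('v \<Rightarrow> ('v \<times> 'c \<Rightarrow> 'k) set) \<Rightarrow> bool" where
  "coaction K C V \<delta> \<longleftrightarrow>
    linear_map K V (tensor_space K V C) \<delta> \<and>
    (\<forall>v\<in>carrier V.
      tensor_assoc K V C C (tensor_map K (tensor_space K V C) C \<delta> (\<lambda>c. c) (\<delta> v)) =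
      tensor_map K V (tensor_space K C C) (\<lambda>v. v) (comul C) (\<delta> v)) \<and>
    (\<forall>v\<in>carrier V.
      tensor_map K V (base_space K) (\<lambda>v. v) (counit C) (\<delta> v) =
      pure_tensor K V (base_space K) v \<one>\<^bsub>K\<^esub>)"

lemma
  assumes "coaction K C V \<delta>"
  shows coaction_linear: "linear_map K V (tensor_space K V C) \<delta>"
    and coaction_coassoc: "v \<in> carrier V \<Longrightarrow>
      tensor_assoc K V C C (tensor_map K (tensor_space K V C) C \<delta> (\<lambda>c. c) (\<delta> v)) =
      tensor_map K V (tensor_space K C C) (\<lambda>v. v) (comul C) (\<delta> v)"
    and coaction_counit: "v \<in> carrier V \<Longrightarrow>
      tensor_map K V (base_space K) (\<lambda>v. v) (counit C) (\<delta> v) =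
      pure_tensor K V (base_space K) v \<one>\<^bsub>K\<^esub>"
  using assms by (simp_all add: coaction_def)

lemma comodule_iff_coaction:
  "comodule K C X \<longleftrightarrow> coalgebra K C \<and> coaction K C X (coact X) \<and> coact X \<in> extensional (carrier X)"
  by (auto simp: comodule_def coaction_def)

lemma coaction_comul: "coalgebra K C \<Longrightarrow> coaction K C C (comul C)"
  by (simp add: coaction_def coalgebra.comul_linear coalgebra.coassoc coalgebra.counit_right)

lemma coalgebra_vectorspace: "coalgebra K C \<Longrightarrow> vectorspace K C"
  by (rule coalgebra.axioms(1))

text \<open>Leads from a coaction back to a comodule record: the space may change its record type,
  and the map may be replaced by its restriction to the carrier.\<close>

lemma coaction_cong:
  assumes C: "coalgebra K C" and "coaction K C V \<delta>" and same: "same_space V V'"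
    and eq: "\<And>v. v \<in> carrier V \<Longrightarrow> \<delta>' v = \<delta> v"
  shows "coaction K C V' \<delta>'"
proof -
  note \<delta> = coaction_linear[OF assms(2)]
  note id = linear_map_id[OF coalgebra_vectorspace[OF C]]
  have *: "tensor_map K (tensor_space K V C) C \<delta>' (\<lambda>c. c) (\<delta> v) =
      tensor_map K (tensor_space K V C) C \<delta> (\<lambda>c. c) (\<delta> v)" if "v \<in> carrier V" for v
    by (rule tensor_map_cong[OF \<delta> id eq _ linear_map_closed[OF \<delta> that]]) auto
  have \<delta>': "coaction K C V \<delta>'"
    using assms(2) linear_map_cong[OF \<delta> eq] by (simp add: coaction_def eq *)
  have "linear_map K V' (tensor_space K V' C) \<delta>'"
    using coaction_linear[OF \<delta>'] same_space_linear_map(1)[OF same] same_space_tensor_space[OF same]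
    by metis
  with \<delta>' show ?thesis
    by (simp add: coaction_def same_space_carrier[OF same, symmetric]
        same_space_tensor_space[OF same, symmetric] same_space_tensor_map[OF same, symmetric]
        same_space_tensor_assoc[OF same, symmetric] same_space_pure_tensor[OF same, symmetric])
qed

lemma
  assumes "f \<in> coalgebra_hom K C D" "coalgebra K C" "coalgebra K D"
  shows coalgebra_hom_linear: "linear_map K C D f"
    and coalgebra_hom_comul: "c \<in> carrier C \<Longrightarrow> tensor_map K D D f f (comul C c) = comul D (f c)"
    and coalgebra_hom_counit: "c \<in> carrier C \<Longrightarrow> counit D (f c) = counit C c"
  using assms by (auto simp: coalgebra_hom_def intro: linear_mapI_module_hom coalgebra_vectorspace)

lemma coaction_induced:
  assumes C: "coalgebra K C" and D: "coalgebra K D" and f: "f \<in> coalgebra_hom K C D"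
    and \<delta>: "coaction K C V \<delta>"
  shows "coaction K D V (\<lambda>v. tensor_map K V D (\<lambda>v. v) f (\<delta> v))"
proof -
  note l = coaction_linear[OF \<delta>] and fl = coalgebra_hom_linear[OF f C D]
  note V = linear_map_id[OF linear_map_dom[OF l]]
  note Cid = linear_map_id[OF coalgebra_vectorspace[OF C]]
    and Did = linear_map_id[OF coalgebra_vectorspace[OF D]]
  note comul = coalgebra.comul_linear[OF C] coalgebra.comul_linear[OF D]
  note counit = coalgebra.counit_linear[OF C] coalgebra.counit_linear[OF D]
  note Vf = linear_map_tensor_map[OF V fl] and ff = linear_map_tensor_map[OF fl fl]
  let ?\<delta> = "\<lambda>v. tensor_map K V D (\<lambda>v. v) f (\<delta> v)"
  let ?VC = "tensor_space K V C" and ?VD = "tensor_space K V D"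
    and ?CC = "tensor_space K C C" and ?DD = "tensor_space K D D" and ?K = "base_space K"
  have l': "linear_map K V ?VD ?\<delta>" by (rule linear_map_comp[OF l Vf])
  show ?thesis
    unfolding coaction_def
  proof (intro conjI ballI l')
    fix v assume v: "v \<in> carrier V"
    note t = linear_map_closed[OF l v]
    \<comment> \<open>All occurrences of \<open>f\<close> are collected so that naturality of the
      associator can move them out as id \<otimes> (f \<otimes> f). What remains inside is
      coassociativity of \<delta> over \<open>C\<close>; comultiplicativity of \<open>f\<close> then
      gives the law over \<open>D\<close>.\<close>
    have "tensor_map K ?VD D ?\<delta> (\<lambda>c. c) (?\<delta> v) = tensor_map K ?VD D ?\<delta> f (\<delta> v)"
      by (rule tensor_map_comp[OF V fl l' Did t])
    also have "\<dots> = tensor_map K ?VD D (tensor_map K V D (\<lambda>v. v) f) f (tensor_map K ?VC C \<delta> (\<lambda>c. c) (\<delta> v))"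
      by (rule tensor_map_comp[OF l Cid Vf fl t, symmetric])
    also have "tensor_assoc K V D D \<dots> =
        tensor_map K V ?DD (\<lambda>v. v) (tensor_map K D D f f)
          (tensor_assoc K V C C (tensor_map K ?VC C \<delta> (\<lambda>c. c) (\<delta> v)))"
      by (rule tensor_assoc_natural[OF V fl fl tensor_map_closed[OF l Cid t]])
    also have "\<dots> = tensor_map K V ?DD (\<lambda>v. v) (tensor_map K D D f f)
          (tensor_map K V ?CC (\<lambda>v. v) (comul C) (\<delta> v))"
      by (simp add: coaction_coassoc[OF \<delta> v])
    also have "\<dots> = tensor_map K V ?DD (\<lambda>v. v) (\<lambda>c. tensor_map K D D f f (comul C c)) (\<delta> v)"
      by (rule tensor_map_comp[OF V comul(1) V ff t])
    also have "\<dots> = tensor_map K V ?DD (\<lambda>v. v) (\<lambda>c. comul D (f c)) (\<delta> v)"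
      by (rule tensor_map_cong[OF V linear_map_comp[OF fl comul(2)] _ _ t])
         (simp_all add: coalgebra_hom_comul[OF f C D])
    also have "\<dots> = tensor_map K V ?DD (\<lambda>v. v) (comul D) (?\<delta> v)"
      by (rule tensor_map_comp[OF V fl V comul(2) t, symmetric])
    finally show "tensor_assoc K V D D (tensor_map K ?VD D ?\<delta> (\<lambda>c. c) (?\<delta> v)) =
        tensor_map K V ?DD (\<lambda>v. v) (comul D) (?\<delta> v)" .
    have "tensor_map K V ?K (\<lambda>v. v) (counit D) (?\<delta> v) =
        tensor_map K V ?K (\<lambda>v. v) (\<lambda>c. counit D (f c)) (\<delta> v)"
      by (rule tensor_map_comp[OF V fl V counit(2) t])
    also have "\<dots> = tensor_map K V ?K (\<lambda>v. v) (counit C) (\<delta> v)"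
      by (rule tensor_map_cong[OF V counit(1) _ _ t]) (simp_all add: coalgebra_hom_counit[OF f C D])
    also have "\<dots> = pure_tensor K V ?K v \<one>\<^bsub>K\<^esub>" by (rule coaction_counit[OF \<delta> v])
    finally show "tensor_map K V ?K (\<lambda>v. v) (counit D) (?\<delta> v) = pure_tensor K V ?K v \<one>\<^bsub>K\<^esub>" .
  qed
qed

text \<open>As \<open>i\<close> has a left inverse, \<open>i \<otimes> id\<close> is injective, so the axioms can be checked after
  applying it.\<close>

lemma coaction_restrict:
  assumes C: "coalgebra K C" and \<delta>: "coaction K C V \<delta>"
    and i: "linear_map K W V i" and q: "linear_map K V W q"
    and qi: "\<And>w. w \<in> carrier W \<Longrightarrow> q (i w) = w"
    and l': "linear_map K W (tensor_space K W C) \<delta>'"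
    and i\<delta>: "\<And>w. w \<in> carrier W \<Longrightarrow> tensor_map K V C i (\<lambda>c. c) (\<delta>' w) = \<delta> (i w)"
  shows "coaction K C W \<delta>'"
proof -
  note l = coaction_linear[OF \<delta>]
  note V = linear_map_id[OF linear_map_cod[OF i]] and W = linear_map_id[OF linear_map_dom[OF i]]
  note Cid = linear_map_id[OF coalgebra_vectorspace[OF C]]
  note CCid = linear_map_id[OF linear_map_cod[OF coalgebra.comul_linear[OF C]]]
  note Kid = linear_map_id[OF linear_map_cod[OF coalgebra.counit_linear[OF C]]]
  note comul = coalgebra.comul_linear[OF C] and counit = coalgebra.counit_linear[OF C]
  let ?VC = "tensor_space K V C" and ?WC = "tensor_space K W C"
    and ?CC = "tensor_space K C C" and ?K = "base_space K"
  note iC = linear_map_tensor_map[OF i Cid]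
  \<comment> \<open>The second factor \<open>Z\<close> is left arbitrary, its type included, since
    the two axioms live over C \<otimes> C and over the ground field.\<close>
  have inj: "s = t"
    if "tensor_map K V Z i (\<lambda>z. z) s = tensor_map K V Z i (\<lambda>z. z) t"
      "s \<in> carrier (tensor_space K W Z)" "t \<in> carrier (tensor_space K W Z)" "linear_map K Z Z (\<lambda>z. z)"
    for s t and Z :: "('a, 'z, 'y) module_scheme"
    using tensor_map_retract[OF i that(4) q that(4) qi _ that(2)]
      tensor_map_retract[OF i that(4) q that(4) qi _ that(3)] that(1) by metis
  show ?thesis
    unfolding coaction_def
  proof (intro conjI ballI l')
    fix w assume w: "w \<in> carrier W"
    note t = linear_map_closed[OF l' w]
    note a = linear_map_tensor_assoc[OF linear_map_dom[OF i] linear_map_dom[OF Cid] linear_map_dom[OF Cid]]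
    let ?a = "tensor_assoc K W C C (tensor_map K ?WC C \<delta>' (\<lambda>c. c) (\<delta>' w))"
    have a: "?a \<in> carrier (tensor_space K W ?CC)"
      by (rule linear_map_closed[OF a tensor_map_closed[OF l' Cid t]])
    have b: "tensor_map K W ?CC (\<lambda>v. v) (comul C) (\<delta>' w) \<in> carrier (tensor_space K W ?CC)"
      by (rule tensor_map_closed[OF W comul t])
    \<comment> \<open>Naturality of the associator involves three separate maps, so the identity of
      C \<otimes> C is first written as id \<otimes> id.\<close>
    have "tensor_map K V ?CC i (\<lambda>c. c) ?a =
        tensor_map K V ?CC i (tensor_map K C C (\<lambda>c. c) (\<lambda>c. c)) ?a"
      by (rule tensor_map_cong[OF i linear_map_tensor_map[OF Cid Cid] _ _ a])
         (simp_all add: tensor_map_id linear_map_dom[OF Cid])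
    also have "\<dots> = tensor_assoc K V C C
        (tensor_map K ?VC C (tensor_map K V C i (\<lambda>c. c)) (\<lambda>c. c) (tensor_map K ?WC C \<delta>' (\<lambda>c. c) (\<delta>' w)))"
      by (rule tensor_assoc_natural[OF i Cid Cid tensor_map_closed[OF l' Cid t], symmetric])
    also have "tensor_map K ?VC C (tensor_map K V C i (\<lambda>c. c)) (\<lambda>c. c) (tensor_map K ?WC C \<delta>' (\<lambda>c. c) (\<delta>' w)) =
        tensor_map K ?VC C (\<lambda>w. tensor_map K V C i (\<lambda>c. c) (\<delta>' w)) (\<lambda>c. c) (\<delta>' w)"
      by (rule tensor_map_comp[OF l' Cid iC Cid t])
    also have "\<dots> = tensor_map K ?VC C (\<lambda>w. \<delta> (i w)) (\<lambda>c. c) (\<delta>' w)"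
      by (rule tensor_map_cong[OF linear_map_comp[OF i l] Cid _ _ t]) (simp_all add: i\<delta>)
    also have "\<dots> = tensor_map K ?VC C \<delta> (\<lambda>c. c) (tensor_map K V C i (\<lambda>c. c) (\<delta>' w))"
      by (rule tensor_map_comp[OF i Cid l Cid t, symmetric])
    also have "\<dots> = tensor_map K ?VC C \<delta> (\<lambda>c. c) (\<delta> (i w))" by (simp add: i\<delta> w)
    also have "tensor_assoc K V C C \<dots> = tensor_map K V ?CC (\<lambda>v. v) (comul C) (\<delta> (i w))"
      by (rule coaction_coassoc[OF \<delta> linear_map_closed[OF i w]])
    also have "\<dots> = tensor_map K V ?CC (\<lambda>v. v) (comul C) (tensor_map K V C i (\<lambda>c. c) (\<delta>' w))"
      by (simp add: i\<delta> w)
    also have "\<dots> = tensor_map K V ?CC i (comul C) (\<delta>' w)"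
      by (rule tensor_map_comp[OF i Cid V comul t])
    also have "\<dots> = tensor_map K V ?CC i (\<lambda>c. c) (tensor_map K W ?CC (\<lambda>v. v) (comul C) (\<delta>' w))"
      by (rule tensor_map_comp[OF W comul i CCid t, symmetric])
    finally show "?a = tensor_map K W ?CC (\<lambda>v. v) (comul C) (\<delta>' w)"
      using a b CCid by (rule inj)
    have c: "tensor_map K W ?K (\<lambda>v. v) (counit C) (\<delta>' w) \<in> carrier (tensor_space K W ?K)"
      by (rule tensor_map_closed[OF W counit t])
    have one: "\<one>\<^bsub>K\<^esub> \<in> carrier ?K"
    proof -
      interpret vectorspace K C by (rule coalgebra_vectorspace[OF C])
      show ?thesis by (simp add: base_space_def)
    qed
    have d: "pure_tensor K W ?K w \<one>\<^bsub>K\<^esub> \<in> carrier (tensor_space K W ?K)"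
      by (rule pure_tensor_closed[OF linear_map_dom[OF W] linear_map_dom[OF Kid] w one])
    have "tensor_map K V ?K i (\<lambda>c. c) (tensor_map K W ?K (\<lambda>v. v) (counit C) (\<delta>' w)) =
        tensor_map K V ?K i (counit C) (\<delta>' w)"
      by (rule tensor_map_comp[OF W counit i Kid t])
    also have "\<dots> = tensor_map K V ?K (\<lambda>v. v) (counit C) (tensor_map K V C i (\<lambda>c. c) (\<delta>' w))"
      by (rule tensor_map_comp[OF i Cid V counit t, symmetric])
    also have "\<dots> = pure_tensor K V ?K (i w) \<one>\<^bsub>K\<^esub>"
      using coaction_counit[OF \<delta> linear_map_closed[OF i w]] by (simp add: i\<delta> w)
    also have "\<dots> = tensor_map K V ?K i (\<lambda>c. c) (pure_tensor K W ?K w \<one>\<^bsub>K\<^esub>)"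
      by (rule tensor_map_pure[OF i Kid w one, symmetric])
    finally show "tensor_map K W ?K (\<lambda>v. v) (counit C) (\<delta>' w) = pure_tensor K W ?K w \<one>\<^bsub>K\<^esub>"
      using c d Kid by (rule inj)
  qed
qed

subsection \<open>Subcomodules\<close>

lemma same_space_induced: "same_space (induced_obj K D f X) X"
  by (simp add: same_space_def induced_obj_def)

lemma carrier_induced_obj: "carrier (induced_obj K D f X) = carrier X"
  and coact_induced_obj:
    "x \<in> carrier X \<Longrightarrow>
      coact (induced_obj K D f X) x = tensor_map K X D (\<lambda>x. x) f (coact X x)"
  by (simp_all add: induced_obj_def)

lemma comodule_vectorspace: "comodule K C X \<Longrightarrow> vectorspace K X"
  by (rule linear_map_dom[OF comodule.coact_linear])

lemma comodule_induced_obj: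
  assumes D: "coalgebra K D" and f: "f \<in> coalgebra_hom K C D" and X: "comodule K C X"
  shows "comodule K D (induced_obj K D f X)"
proof -
  have C: "coalgebra K C" and \<delta>: "coaction K C X (coact X)"
    using X by (simp_all add: comodule_iff_coaction)
  have "coaction K D (induced_obj K D f X) (coact (induced_obj K D f X))"
    by (rule coaction_cong[OF D coaction_induced[OF C D f \<delta>] same_space_sym[OF same_space_induced]])
       (simp add: induced_obj_def)
  then show ?thesis
    using D by (simp add: comodule_iff_coaction induced_obj_def)
qed

lemma subspace_induced_obj:
  assumes "vectorspace K X"
  shows "subspace K A (induced_obj K D f X) \<longleftrightarrow> subspace K A X"
proof -
  have "vectorspace K (induced_obj K D f X)"
    using assms same_space_vectorspace[OF same_space_induced] by blast
  then show ?thesis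
    using assms
    by (auto simp: subspace_def submodule_def induced_obj_def vectorspace_def)
qed

lemma subspace_inclusion_linear:
  assumes A: "subspace K A X"
  shows "linear_map K (X\<lparr>carrier := A\<rparr>) X (\<lambda>x. x)"
proof -
  interpret X: vectorspace K X using A by (rule subspace.vs)
  have "A \<subseteq> carrier X" using A by (simp add: subspace_def submodule_def)
  then show ?thesis
    by (intro linear_mapI X.subspace_is_vs[OF A] X.vectorspace_axioms) auto
qed

lemma linear_map_into_subspace:
  assumes A: "subspace K A X" and g: "linear_map K V X g"
    and gA: "\<And>v. v \<in> carrier V \<Longrightarrow> g v \<in> A"
  shows "linear_map K V (X\<lparr>carrier := A\<rparr>) g"
  using gA linear_map_add[OF g] linear_map_smult[OF g]
  by (intro linear_mapI linear_map_dom[OF g] linear_map_dom[OF subspace_inclusion_linear[OF A]]) auto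

text \<open>The projection \<open>q\<close> makes the subspace a retract, so
  \<open>coaction_restrict\<close> supplies coassociativity and the counit law; only the agreement
  with the coaction of \<open>X\<close> has to be provided. The record update keeps all other
  fields, as the equation in \<open>subcomodule\<close> demands.\<close>

lemma subcomoduleI:
  fixes X :: "('k, 'x, 'c) comodule"
  assumes X: "comodule K C X" and A: "subspace K A X"
    and q: "linear_map K X (X\<lparr>carrier := A\<rparr>) q" and qA: "\<And>x. x \<in> A \<Longrightarrow> q x = x"
    and \<delta>: "linear_map K (X\<lparr>carrier := A\<rparr>) (tensor_space K (X\<lparr>carrier := A\<rparr>) C) \<delta>"
    and eq: "\<And>x. x \<in> A \<Longrightarrow> tensor_map K X C (\<lambda>x. x) (\<lambda>c. c) (\<delta> x) = coact X x"
  shows "subcomodule K C (X\<lparr>carrier := A, coact := restrict \<delta> A\<rparr>) X"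
proof -
  let ?W = "X\<lparr>carrier := A\<rparr>" and ?Y = "X\<lparr>carrier := A, coact := restrict \<delta> A\<rparr>"
  have C: "coalgebra K C" and \<delta>X: "coaction K C X (coact X)"
    using X by (simp_all add: comodule_iff_coaction)
  note i = subspace_inclusion_linear[OF A]
  note Cid = linear_map_id[OF coalgebra_vectorspace[OF C]]
  have same: "same_space ?W ?Y" by (simp add: same_space_def)
  have W: "coaction K C ?W \<delta>"
    by (rule coaction_restrict[OF C \<delta>X i q _ \<delta>]) (simp_all add: qA eq)
  have "coaction K C ?Y (coact ?Y)"
    by (rule coaction_cong[OF C W same]) simp
  then have Y: "comodule K C ?Y" using C by (simp add: comodule_iff_coaction)
  have iY: "linear_map K ?Y X (\<lambda>x. x)" using i same_space_linear_map(1)[OF same] by metis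
  have "(\<lambda>y\<in>A. y) \<in> comodule_hom K C ?Y X"
    unfolding comodule_hom_def
  proof (intro CollectI conjI ballI)
    show "(\<lambda>y\<in>A. y) \<in> module_hom K ?Y X"
      using linear_map_cong[OF iY, of "\<lambda>y\<in>A. y"] by (simp add: linear_map_iff)
    fix x assume x: "x \<in> carrier ?Y"
    have "tensor_map K X C (\<lambda>y\<in>A. y) (\<lambda>c. c) (\<delta> x) = tensor_map K X C (\<lambda>y. y) (\<lambda>c. c) (\<delta> x)"
      by (rule tensor_map_cong[OF i Cid _ _ linear_map_closed[OF \<delta>]]) (use x in auto)
    then show "coact X ((\<lambda>y\<in>A. y) x) = tensor_map K X C (\<lambda>y\<in>A. y) (\<lambda>c. c) (coact ?Y x)"
      using x by (simp add: eq)
  qed simp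
  with X Y A show ?thesis by (simp add: subcomodule_def)
qed

text \<open>A subcomodule is given with the extensional inclusion; here it is exchanged for the
  plain identity, which composes well under \<open>tensor_map\<close>.\<close>

lemma
  fixes X :: "('k, 'x, 'c) comodule"
  assumes sub: "subcomodule K C Y X"
  shows subcomodule_coaction: "coaction K C Y (coact Y)"
    and subcomodule_inclusion: "linear_map K Y X (\<lambda>y. y)"
    and subcomodule_coact:
      "y \<in> carrier Y \<Longrightarrow> tensor_map K X C (\<lambda>y. y) (\<lambda>c. c) (coact Y y) = coact X y"
proof -
  have C: "coalgebra K C" and A: "subspace K (carrier Y) X"
    and i: "(\<lambda>y\<in>carrier Y. y) \<in> comodule_hom K C Y X"
    and Yeq: "Y = X\<lparr>carrier := carrier Y, coact := coact Y\<rparr>"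
    using sub by (simp_all add: subcomodule_def comodule_def)
  show \<delta>: "coaction K C Y (coact Y)"
    using sub by (simp add: subcomodule_def comodule_iff_coaction)
  note Cid = linear_map_id[OF coalgebra_vectorspace[OF C]]
  have same: "same_space Y (X\<lparr>carrier := carrier Y\<rparr>)"
    by (subst Yeq) (simp add: same_space_def)
  show incl: "linear_map K Y X (\<lambda>y. y)"
    using subspace_inclusion_linear[OF A] same_space_linear_map(1)[OF same] by metis
  assume y: "y \<in> carrier Y"
  have "coact X y = tensor_map K X C (\<lambda>y\<in>carrier Y. y) (\<lambda>c. c) (coact Y y)"
    using i y by (auto simp: comodule_hom_def)
  also have "\<dots> = tensor_map K X C (\<lambda>y. y) (\<lambda>c. c) (coact Y y)"
    by (rule tensor_map_cong[OF incl Cid _ _ linear_map_closed[OF coaction_linear[OF \<delta>] y]]) auto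
  finally show "tensor_map K X C (\<lambda>y. y) (\<lambda>c. c) (coact Y y) = coact X y" by simp
qed

section \<open>Copying the regular comodule into the universe\<close>

lemma injection_into_universe:
  fixes K :: "('k, 'm) ring_scheme" and V :: "('k, 'v, 'n) module_scheme"
  assumes V: "vectorspace K V" and fin: "vectorspace.fin_dim K V"
    and univ: "fin_dim_universe K TYPE('x)"
  obtains j :: "'v \<Rightarrow> 'x" where "inj_on j (carrier V)"
proof -
  interpret V: vectorspace K V by (rule V)
  obtain A where A: "finite A" "A \<subseteq> carrier V" "V.span A = carrier V"
    using fin by (auto simp: V.fin_dim_def)
  obtain b where b: "bij_betw b {0..<card A} A" using ex_bij_betw_nat_finite[OF A(1)] by blast
  obtain e :: "(nat \<Rightarrow> 'k) \<Rightarrow> 'x" where e: "inj_on e ({..<card A} \<rightarrow>\<^sub>E carrier K)"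
    using univ unfolding fin_dim_universe_def by blast
  have "\<forall>v\<in>carrier V. \<exists>a. a \<in> A \<rightarrow> carrier K \<and> V.lincomb a A = v"
    using V.finite_in_span[OF A(1,2)] A(3) by simp
  then obtain a where a: "\<And>v. v \<in> carrier V \<Longrightarrow> a v \<in> A \<rightarrow> carrier K"
    and lc: "\<And>v. v \<in> carrier V \<Longrightarrow> V.lincomb (a v) A = v"
    by metis
  \<comment> \<open>Chosen coefficients over a finite spanning set, indexed by numbers. They need
    not be the only ones: a vector is determined by its coefficients, and this already gives
    injectivity.\<close>
  let ?c = "\<lambda>v. \<lambda>n\<in>{..<card A}. a v (b n)"
  have c: "?c v \<in> {..<card A} \<rightarrow>\<^sub>E carrier K" if "v \<in> carrier V" for v
    using a[OF that] b by (auto simp: bij_betw_def)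
  have "v = w" if v: "v \<in> carrier V" and w: "w \<in> carrier V" and eq: "?c v = ?c w" for v w
  proof -
    have "a v x = a w x" if "x \<in> A" for x
    proof -
      have "x \<in> b ` {0..<card A}" using that b by (simp add: bij_betw_def)
      then obtain n where n: "n < card A" "x = b n" by auto
      then show ?thesis using fun_cong[OF eq, of n] by simp
    qed
    then have "V.lincomb (a v) A = V.lincomb (a w) A"
      using a[OF w] A(2) by (intro V.lincomb_cong) auto
    then show ?thesis by (simp add: lc v w)
  qed
  with e c have "inj_on (\<lambda>v. e (?c v)) (carrier V)"
    by (intro inj_onI) (metis (no_types, lifting) inj_onD)
  then show ?thesis by (rule that)
qed

text \<open>The structure of \<open>C\<close> is transported along an injection \<open>j\<close> of
  its carrier into \<open>'x\<close>. The last conclusion says that \<psi> is compatible with the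
  coactions of \<open>X\<close> and of \<open>C\<close>, which is how the comultiplication enters
  the argument about kernels.\<close>

lemma comodule_copy_in_universe:
  fixes K :: "('k, 'm) ring_scheme" and C :: "('k, 'c, 'n) coalgebra_scheme"
  assumes C: "fin_dim_coalgebra K C" and univ: "fin_dim_universe K TYPE('x)"
  obtains X :: "('k, 'x, 'c) comodule" and \<phi> \<psi> where
    "X \<in> fin_dim_comodules K C" "linear_map K C X \<phi>" "linear_map K X C \<psi>"
    "\<And>c. c \<in> carrier C \<Longrightarrow> \<psi> (\<phi> c) = c"
    "\<And>x. x \<in> carrier X \<Longrightarrow> tensor_map K C C \<psi> (\<lambda>c. c) (coact X x) = comul C (\<psi> x)"
proof -
  have Ca: "coalgebra K C" and fin: "vectorspace.fin_dim K C"
    using C by (simp_all add: fin_dim_coalgebra_def)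
  note Cv = coalgebra_vectorspace[OF Ca]
  note Cid = linear_map_id[OF Cv]
  interpret C: vectorspace K C by (rule Cv)
  obtain j :: "'c \<Rightarrow> 'x" where j: "inj_on j (carrier C)"
    using injection_into_universe[OF Cv fin univ] .
  define \<psi> where "\<psi> = inv_into (carrier C) j"
  have \<psi>j: "\<psi> (j c) = c" if "c \<in> carrier C" for c
    using j that by (simp add: \<psi>_def)
  define M :: "('k, 'x) module" where "M =
    \<lparr>carrier = j ` carrier C, mult = (\<lambda>_ _. j \<zero>\<^bsub>C\<^esub>), one = j \<zero>\<^bsub>C\<^esub>, zero = j \<zero>\<^bsub>C\<^esub>,
     add = (\<lambda>x y. j (\<psi> x \<oplus>\<^bsub>C\<^esub> \<psi> y)), smult = (\<lambda>a x. j (a \<odot>\<^bsub>C\<^esub> \<psi> x))\<rparr>"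
  have jl: "linear_map K C M j"
    by (rule vectorspace_surj_image[OF Cv]) (simp_all add: M_def \<psi>j)
  have bij: "bij_betw j (carrier C) (carrier M)" using j by (simp add: bij_betw_def M_def)
  have \<psi>l: "linear_map K M C \<psi>"
    unfolding \<psi>_def by (rule linear_map_inverse[OF jl bij])
  have j\<psi>: "j (\<psi> x) = x" if "x \<in> carrier M" for x
    using that by (auto simp: M_def \<psi>j)
  \<comment> \<open>Only the first factor is relabelled; the second remains in
    \<open>C\<close>.\<close>
  define \<delta> where "\<delta> x = tensor_map K M C j (\<lambda>c. c) (comul C (\<psi> x))" for x
  note comul = coalgebra.comul_linear[OF Ca]
  have \<delta>l: "linear_map K M (tensor_space K M C) \<delta>"
    unfolding \<delta>_def
    by (rule linear_map_comp[OF linear_map_comp[OF \<psi>l comul] linear_map_tensor_map[OF jl Cid]])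
  have \<psi>\<delta>: "tensor_map K C C \<psi> (\<lambda>c. c) (\<delta> x) = comul C (\<psi> x)" if "x \<in> carrier M" for x
    unfolding \<delta>_def
    by (rule tensor_map_retract[OF jl Cid \<psi>l Cid])
       (simp_all add: \<psi>j linear_map_closed[OF comul linear_map_closed[OF \<psi>l that]])
  \<comment> \<open>The isomorphism \<psi> plays the part of the inclusion, with \<open>j\<close> as
    its left inverse, so the axioms are inherited from the regular coaction.\<close>
  have M: "coaction K C M \<delta>"
    by (rule coaction_restrict[OF Ca coaction_comul[OF Ca] \<psi>l jl j\<psi> \<delta>l \<psi>\<delta>])
  define X :: "('k, 'x, 'c) comodule" where "X =
    \<lparr>carrier = carrier M, mult = mult M, one = one M, zero = zero M, add = add M, smult = smult M,
     coact = restrict \<delta> (carrier M)\<rparr>"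
  have same: "same_space M X" by (simp add: same_space_def X_def)
  have "coaction K C X (coact X)"
    by (rule coaction_cong[OF Ca M same]) (simp add: X_def)
  then have Xc: "comodule K C X" using Ca by (simp add: comodule_iff_coaction X_def)
  have jX: "linear_map K C X j" using jl same_space_linear_map(2)[OF same] by metis
  have "vectorspace.fin_dim K X"
    by (rule linear_map.surj_fin_dim[OF jX fin]) (simp add: X_def M_def)
  with Xc have "X \<in> fin_dim_comodules K C" by (simp add: fin_dim_comodules_def)
  moreover have "linear_map K X C \<psi>" using \<psi>l same_space_linear_map(1)[OF same] by metis
  ultimately show ?thesis
    using jX \<psi>j \<psi>\<delta> by (intro that[of X j \<psi>]) (simp_all add: X_def)
qed

subsection \<open>Injectivity of the coalgebra homomorphism\<close>

text \<open>Linearity and extensionality do not involve the coaction, so only compatibility is at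
  stake. Its two sides agree after id \<otimes> f, and id \<otimes> p removes \<open>f\<close>
  again.\<close>

lemma induced_full:
  assumes C: "fin_dim_coalgebra K C" and D: "fin_dim_coalgebra K D"
    and f: "f \<in> coalgebra_hom K C D" and inj: "inj_on f (carrier C)"
    and X: "comodule K C X" and Y: "comodule K C Y"
    and g: "g \<in> comodule_hom K D (induced_obj K D f X) (induced_obj K D f Y)"
  shows "g \<in> comodule_hom K C X Y"
proof -
  have Ca: "coalgebra K C" and Da: "coalgebra K D" and Dfin: "vectorspace.fin_dim K D"
    using C D by (simp_all add: fin_dim_coalgebra_def)
  note fl = coalgebra_hom_linear[OF f Ca Da]
  obtain p where p: "linear_map K D C p" and pf: "\<And>c. c \<in> carrier C \<Longrightarrow> p (f c) = c"
    using injective_linear_map_left_inverse[OF fl inj Dfin] by blast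
  note Cid = linear_map_id[OF coalgebra_vectorspace[OF Ca]]
    and Did = linear_map_id[OF coalgebra_vectorspace[OF Da]]
  note dX = comodule.coact_linear[OF X] and dY = comodule.coact_linear[OF Y]
  note Yid = linear_map_id[OF comodule_vectorspace[OF Y]]
    and Xid = linear_map_id[OF comodule_vectorspace[OF X]]
  have gX: "g \<in> module_hom K X Y" "g \<in> extensional (carrier X)"
    using g by (auto simp: comodule_hom_def module_hom_def induced_obj_def)
  have gl: "linear_map K X Y g"
    by (rule linear_mapI_module_hom[OF comodule_vectorspace[OF X] comodule_vectorspace[OF Y] gX(1)])
  have "coact Y (g x) = tensor_map K Y C g (\<lambda>c. c) (coact X x)" if x: "x \<in> carrier X" for x
  proof -
    note t = linear_map_closed[OF dX x] and s = linear_map_closed[OF dY linear_map_closed[OF gl x]]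
    note t' = tensor_map_closed[OF gl Cid t]
    have "coact (induced_obj K D f Y) (g x) =
        tensor_map K Y D g (\<lambda>d. d) (coact (induced_obj K D f X) x)"
      using g x
      by (simp add: comodule_hom_def carrier_induced_obj same_space_tensor_map[OF same_space_induced])
    then have "tensor_map K Y D (\<lambda>y. y) f (coact Y (g x)) =
        tensor_map K Y D g (\<lambda>d. d) (tensor_map K X D (\<lambda>x. x) f (coact X x))"
      using x linear_map_closed[OF gl x] by (simp add: coact_induced_obj)
    also have "\<dots> = tensor_map K Y D g f (coact X x)"
      by (rule tensor_map_comp[OF Xid fl gl Did t])
    also have "\<dots> = tensor_map K Y D (\<lambda>y. y) f (tensor_map K Y C g (\<lambda>c. c) (coact X x))"
      by (rule tensor_map_comp[OF gl Cid Yid fl t, symmetric])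
    finally have "tensor_map K Y C (\<lambda>y. y) p (tensor_map K Y D (\<lambda>y. y) f (coact Y (g x))) =
        tensor_map K Y C (\<lambda>y. y) p (tensor_map K Y D (\<lambda>y. y) f (tensor_map K Y C g (\<lambda>c. c) (coact X x)))"
      by simp
    then show ?thesis
      using tensor_map_retract[OF Yid fl Yid p _ pf s] tensor_map_retract[OF Yid fl Yid p _ pf t']
      by simp
  qed
  with gX show ?thesis by (simp add: comodule_hom_def)
qed

lemma induced_subobject_closed:
  fixes X :: "('k, 'x, 'c) comodule"
  assumes C: "fin_dim_coalgebra K C" and D: "fin_dim_coalgebra K D"
    and f: "f \<in> coalgebra_hom K C D" and inj: "inj_on f (carrier C)"
    and X: "X \<in> fin_dim_comodules K C"
    and Y: "subcomodule K D Y (induced_obj K D f X)"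
  shows "\<exists>X'. subcomodule K C X' X \<and> induced_obj K D f X' = Y"
proof -
  have Ca: "coalgebra K C" and Da: "coalgebra K D" and Dfin: "vectorspace.fin_dim K D"
    using C D by (simp_all add: fin_dim_coalgebra_def)
  have Xc: "comodule K C X" and Xfin: "vectorspace.fin_dim K X"
    using X by (simp_all add: fin_dim_comodules_def)
  note Xv = comodule_vectorspace[OF Xc]
  note fl = coalgebra_hom_linear[OF f Ca Da]
  obtain p where p: "linear_map K D C p" and pf: "\<And>c. c \<in> carrier C \<Longrightarrow> p (f c) = c"
    using injective_linear_map_left_inverse[OF fl inj Dfin] by blast
  let ?A = "carrier Y" and ?W = "X\<lparr>carrier := carrier Y\<rparr>" and ?Z = "induced_obj K D f X"
  have A: "subspace K ?A X"
    using Y subspace_induced_obj[OF Xv] by (auto simp: subcomodule_def)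
  note i = subspace_inclusion_linear[OF A] and Wv = linear_map_dom[OF subspace_inclusion_linear[OF A]]
  have Yeq: "Y = ?Z\<lparr>carrier := ?A, coact := coact Y\<rparr>" using Y by (simp add: subcomodule_def)
  have YW: "same_space Y ?W"
    by (subst Yeq) (simp add: same_space_def induced_obj_def)
  \<comment> \<open>A linear projection onto the subspace. It is used twice: to pass the coaction
    axioms to the subspace, and to make i \<otimes> id injective over \<open>D\<close>.\<close>
  obtain q where q: "linear_map K X ?W q" and qi: "\<And>y. y \<in> ?A \<Longrightarrow> q y = y"
    using injective_linear_map_left_inverse[OF i _ Xfin] by (auto simp: inj_on_def)
  note Cid = linear_map_id[OF coalgebra_vectorspace[OF Ca]]
    and Did = linear_map_id[OF coalgebra_vectorspace[OF Da]]
    and Xid = linear_map_id[OF Xv] and Wid = linear_map_id[OF Wv]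
  note dX = comodule.coact_linear[OF Xc]
  have dY: "linear_map K ?W (tensor_space K ?W D) (coact Y)"
    using coaction_linear[OF subcomodule_coaction[OF Y]]
      same_space_linear_map(1)[OF YW] same_space_tensor_space[OF YW] by metis
  have AX: "y \<in> carrier X" if "y \<in> ?A" for y
    using linear_map_closed[OF i] that by simp
  have coY: "tensor_map K X D (\<lambda>y. y) (\<lambda>d. d) (coact Y y) = tensor_map K X D (\<lambda>x. x) f (coact X y)"
    if "y \<in> ?A" for y
    using subcomodule_coact[OF Y that] AX[OF that]
    by (simp add: same_space_tensor_map[OF same_space_induced] coact_induced_obj)
  \<comment> \<open>The only candidate: a coaction with (id \<otimes> f) \<circ> \<delta> =
    \<open>coact Y\<close> is recovered by applying id \<otimes> p.\<close>
  define \<delta> where "\<delta> y = tensor_map K ?W C (\<lambda>y. y) p (coact Y y)" for y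
  have \<delta>: "linear_map K ?W (tensor_space K ?W C) \<delta>"
    unfolding \<delta>_def by (rule linear_map_comp[OF dY linear_map_tensor_map[OF Wid p]])
  have \<delta>X: "tensor_map K X C (\<lambda>x. x) (\<lambda>c. c) (\<delta> y) = coact X y" if y: "y \<in> ?A" for y
  proof -
    have t: "coact Y y \<in> carrier (tensor_space K ?W D)" using linear_map_closed[OF dY] y by simp
    note s = linear_map_closed[OF dX AX[OF y]]
    have "tensor_map K X C (\<lambda>x. x) (\<lambda>c. c) (\<delta> y) = tensor_map K X C (\<lambda>x. x) p (coact Y y)"
      unfolding \<delta>_def by (rule tensor_map_comp[OF Wid p i Cid t])
    also have "\<dots> = tensor_map K X C (\<lambda>x. x) p (tensor_map K X D (\<lambda>x. x) (\<lambda>d. d) (coact Y y))"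
      by (rule tensor_map_comp[OF i Did Xid p t, symmetric])
    also have "\<dots> = coact X y"
      unfolding coY[OF y] by (rule tensor_map_retract[OF Xid fl Xid p _ pf s]) auto
    finally show ?thesis .
  qed
  let ?X' = "X\<lparr>carrier := ?A, coact := restrict \<delta> ?A\<rparr>"
  have "subcomodule K C ?X' X"
    by (rule subcomoduleI[OF Xc A q qi \<delta> \<delta>X])
  moreover have "induced_obj K D f ?X' = Y"
  proof -
    have X'W: "same_space ?X' ?W" by (simp add: same_space_def)
    have "tensor_map K ?W D (\<lambda>x. x) f (\<delta> y) = coact Y y" if y: "y \<in> ?A" for y
    proof -
      have t: "coact Y y \<in> carrier (tensor_space K ?W D)" using linear_map_closed[OF dY] y by simp
      have d: "\<delta> y \<in> carrier (tensor_space K ?W C)" using linear_map_closed[OF \<delta>] y by simp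
      note t' = tensor_map_closed[OF Wid fl d]
      \<comment> \<open>Since f p need not be the identity, the equation is not immediate from the
        definition of \<delta>. It is compared in X \<otimes> D, where both sides are the induced
        coaction of \<open>X\<close>, and then pulled back along the injective i \<otimes>
        id.\<close>
      have "tensor_map K X D (\<lambda>x. x) (\<lambda>d. d) (tensor_map K ?W D (\<lambda>x. x) f (\<delta> y)) =
          tensor_map K X D (\<lambda>x. x) f (\<delta> y)"
        by (rule tensor_map_comp[OF Wid fl i Did d])
      also have "\<dots> = tensor_map K X D (\<lambda>x. x) f (tensor_map K X C (\<lambda>x. x) (\<lambda>c. c) (\<delta> y))"
        by (rule tensor_map_comp[OF i Cid Xid fl d, symmetric])
      also have "\<dots> = tensor_map K X D (\<lambda>x. x) (\<lambda>d. d) (coact Y y)"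
        by (simp add: \<delta>X y coY)
      finally show ?thesis
        using tensor_map_retract[OF i Did q Did _ _ t] tensor_map_retract[OF i Did q Did _ _ t'] qi
        by simp
    qed
    \<comment> \<open>Agreement on the carrier becomes equality of functions, so that the two
      records are equal and not merely isomorphic.\<close>
    moreover have "coact Y \<in> extensional ?A"
      using Y comodule.coact_extensional unfolding subcomodule_def by blast
    ultimately have "(\<lambda>y\<in>?A. tensor_map K ?X' D (\<lambda>x. x) f (restrict \<delta> ?A y)) = coact Y"
      by (intro extensionalityI[of _ ?A]) (simp_all add: same_space_tensor_map[OF X'W])
    then show ?thesis
      by (subst Yeq) (simp add: induced_obj_def)
  qed
  ultimately show ?thesis by blast
qed

section \<open>Closure under subobjects forces injectivity\<close>

lemma subobject_closed_imp_inj: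
  fixes K :: "('k, 'm) ring_scheme"
    and C :: "('k, 'c, 'n) coalgebra_scheme" and D :: "('k, 'd, 'o) coalgebra_scheme"
  assumes C: "fin_dim_coalgebra K C" and D: "fin_dim_coalgebra K D"
    and f: "f \<in> coalgebra_hom K C D" and univ: "fin_dim_universe K TYPE('x)"
    and closed: "\<And>X Y. X \<in> fin_dim_comodules K C \<Longrightarrow>
      subcomodule K D Y (induced_obj K D f (X :: ('k, 'x, 'c) comodule)) \<Longrightarrow>
      \<exists>X'. subcomodule K C X' X \<and> induced_obj K D f X' = Y"
  shows "inj_on f (carrier C)"
proof -
  have Ca: "coalgebra K C" and Da: "coalgebra K D" and Dfin: "vectorspace.fin_dim K D"
    using C D by (simp_all add: fin_dim_coalgebra_def)
  note fl = coalgebra_hom_linear[OF f Ca Da]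
  obtain X :: "('k, 'x, 'c) comodule" and \<phi> \<psi> where X: "X \<in> fin_dim_comodules K C"
    and \<phi>: "linear_map K C X \<phi>" and \<psi>: "linear_map K X C \<psi>"
    and \<psi>\<phi>: "\<And>c. c \<in> carrier C \<Longrightarrow> \<psi> (\<phi> c) = c"
    and \<psi>X: "\<And>x. x \<in> carrier X \<Longrightarrow> tensor_map K C C \<psi> (\<lambda>c. c) (coact X x) = comul C (\<psi> x)"
    using comodule_copy_in_universe[OF C univ] by blast
  have Xc: "comodule K C X" using X by (simp add: fin_dim_comodules_def)
  interpret D: vectorspace K D by (rule coalgebra_vectorspace[OF Da])
  interpret X: vectorspace K X by (rule comodule_vectorspace[OF Xc])
  note dX = comodule.coact_linear[OF Xc]
  let ?Z = "induced_obj K D f X"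
  have Zc: "comodule K D ?Z" by (rule comodule_induced_obj[OF Da f Xc])
  have ZX: "same_space ?Z X" by (rule same_space_induced)
  \<comment> \<open>This is \<open>f\<close> read on the copy \<open>X\<close>; its kernel
    \<open>A\<close> corresponds to the kernel of \<open>f\<close> under \<psi>.\<close>
  define \<eta> where "\<eta> x = f (\<psi> x)" for x
  have \<eta>: "linear_map K X D \<eta>" unfolding \<eta>_def by (rule linear_map_comp[OF \<psi> fl])
  interpret \<eta>: linear_map K X D \<eta> by (rule \<eta>)
  define A where "A = {x \<in> carrier X. \<eta> x = \<zero>\<^bsub>D\<^esub>}"
  have A: "subspace K A X"
    using \<eta>.kerT_is_subspace by (simp add: A_def \<eta>.ker_def)
  let ?W = "X\<lparr>carrier := A\<rparr>" and ?W' = "?Z\<lparr>carrier := A\<rparr>"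
  have WW: "same_space ?W' ?W" by (simp add: same_space_def induced_obj_def)
  have AZ: "subspace K A ?Z" using A subspace_induced_obj[OF X.vectorspace_axioms] by blast
  obtain s where s: "linear_map K D X s" and \<eta>s: "\<And>x. x \<in> carrier X \<Longrightarrow> \<eta> (s (\<eta> x)) = \<eta> x"
    using linear_map_generalized_inverse[OF \<eta> Dfin] by blast
  \<comment> \<open>\<open>q = id - s \<circ> \<eta>\<close> projects onto \<open>A\<close>, and \<open>(s \<circ> \<eta>) \<otimes> f\<close> kills \<open>coact X x\<close> for \<open>x\<close> in \<open>A\<close>
    because \<open>(\<eta> \<otimes> f) (coact X x) = \<Delta> (\<eta> x)\<close>.\<close>
  note s\<eta> = linear_map_comp[OF \<eta> s]
  define m where "m = \<ominus>\<^bsub>K\<^esub> \<one>\<^bsub>K\<^esub>"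
  have m: "m \<in> carrier K" by (simp add: m_def)
  define q where "q x = x \<oplus>\<^bsub>X\<^esub> m \<odot>\<^bsub>X\<^esub> s (\<eta> x)" for x
  note Xid = linear_map_id[OF X.vectorspace_axioms]
    and Cid = linear_map_id[OF coalgebra_vectorspace[OF Ca]]
    and Did = linear_map_id[OF coalgebra_vectorspace[OF Da]]
  have qX: "linear_map K X X q"
    unfolding q_def by (rule linear_map_sum[OF Xid linear_map_scale[OF s\<eta> m]])
  have qA: "q x \<in> A" if "x \<in> carrier X" for x
  proof -
    have "\<eta> (q x) = \<eta> x \<oplus>\<^bsub>D\<^esub> m \<odot>\<^bsub>D\<^esub> \<eta> x"
      using that m linear_map_closed[OF s\<eta>]
      by (simp add: q_def linear_map_add[OF \<eta>] linear_map_smult[OF \<eta>] \<eta>s)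
    also have "\<dots> = \<zero>\<^bsub>D\<^esub>"
      using linear_map_closed[OF \<eta> that] by (simp add: m_def D.smult_minus_1 D.M.r_neg)
    finally show ?thesis using linear_map_closed[OF qX that] by (simp add: A_def)
  qed
  have q: "linear_map K X ?W q" by (rule linear_map_into_subspace[OF A qX qA])
  have qi: "q x = x" if "x \<in> A" for x
    using that m by (simp add: A_def q_def linear_map_zero[OF s])
  note i = subspace_inclusion_linear[OF A]
  have AX: "x \<in> carrier X" if "x \<in> A" for x using that by (simp add: A_def)
  \<comment> \<open>With \<open>q\<close> as the first factor the values lie in A \<otimes> D by
    construction. Replacing \<open>q\<close> by the identity does not change the value in X
    \<otimes> D when \<open>x\<close> is in \<open>A\<close>, which is shown next.\<close>
  define \<delta> where "\<delta> x = tensor_map K ?W D q f (coact X x)" for x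
  have \<delta>: "linear_map K ?W (tensor_space K ?W D) \<delta>"
    unfolding \<delta>_def by (rule linear_map_comp[OF linear_map_comp[OF i dX] linear_map_tensor_map[OF q fl]])
  have \<delta>Z: "tensor_map K ?Z D (\<lambda>x. x) (\<lambda>d. d) (\<delta> x) = coact ?Z x" if x: "x \<in> A" for x
  proof -
    note t = linear_map_closed[OF dX AX[OF x]]
    let ?T = "tensor_space K X D"
    interpret T: vectorspace K ?T
      by (rule vectorspace_tensor[OF X.vectorspace_axioms coalgebra_vectorspace[OF Da]])
    have "tensor_map K X D (\<lambda>x. s (\<eta> x)) f (coact X x) =
        tensor_map K X D s (\<lambda>d. d) (tensor_map K D D \<eta> f (coact X x))"
      by (rule tensor_map_comp[OF \<eta> fl s Did t, symmetric])
    also have "tensor_map K D D \<eta> f (coact X x) =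
        tensor_map K D D f f (tensor_map K C C \<psi> (\<lambda>c. c) (coact X x))"
      unfolding \<eta>_def by (rule tensor_map_comp[OF \<psi> Cid fl fl t, symmetric])
    also have "\<dots> = comul D (\<eta> x)"
      unfolding \<psi>X[OF AX[OF x]] \<eta>_def
      by (rule coalgebra_hom_comul[OF f Ca Da linear_map_closed[OF \<psi> AX[OF x]]])
    also have "\<dots> = \<zero>\<^bsub>tensor_space K D D\<^esub>"
      using x linear_map_zero[OF coalgebra.comul_linear[OF Da]] by (simp add: A_def)
    also have "tensor_map K X D s (\<lambda>d. d) \<dots> = \<zero>\<^bsub>?T\<^esub>"
      by (rule linear_map_zero[OF linear_map_tensor_map[OF s Did]])
    finally have 0: "tensor_map K X D (\<lambda>x. s (\<eta> x)) f (coact X x) = \<zero>\<^bsub>?T\<^esub>" .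
    have "tensor_map K X D (\<lambda>x. x) (\<lambda>d. d) (\<delta> x) = tensor_map K X D q f (coact X x)"
      unfolding \<delta>_def by (rule tensor_map_comp[OF q fl i Did t])
    also have "\<dots> = tensor_map K X D (\<lambda>x. x) f (coact X x) \<oplus>\<^bsub>?T\<^esub>
        m \<odot>\<^bsub>?T\<^esub> tensor_map K X D (\<lambda>x. s (\<eta> x)) f (coact X x)"
      unfolding q_def by (rule tensor_map_add_scale_left[OF Xid s\<eta> fl m t])
    also have "\<dots> = tensor_map K X D (\<lambda>x. x) f (coact X x)"
      using m tensor_map_closed[OF Xid fl t] by (simp add: 0)
    finally show ?thesis
      unfolding same_space_tensor_map[OF ZX] using AX[OF x] by (simp add: coact_induced_obj)
  qed
  let ?Y = "?Z\<lparr>carrier := A, coact := restrict \<delta> A\<rparr>"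
  have "subcomodule K D ?Y ?Z"
  proof (rule subcomoduleI[OF Zc AZ _ qi _ \<delta>Z])
    show "linear_map K ?Z ?W' q"
      using q same_space_linear_map(1)[OF ZX] same_space_linear_map(2)[OF WW] by metis
    show "linear_map K ?W' (tensor_space K ?W' D) \<delta>"
      using \<delta> same_space_linear_map(1)[OF WW] same_space_tensor_space[OF WW] by metis
  qed
  then obtain X' where X': "subcomodule K C X' X" "induced_obj K D f X' = ?Y"
    using closed[OF X] by blast
  have "carrier (induced_obj K D f X') = A" by (simp add: X'(2))
  then have X'A: "carrier X' = A" by (simp add: carrier_induced_obj)
  have \<psi>A: "\<psi> x = \<zero>\<^bsub>C\<^esub>" if x: "x \<in> A" for x
  proof -
    let ?K = "base_space K"
    note \<epsilon> = coalgebra.counit_linear[OF Ca]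
    note i' = subcomodule_inclusion[OF X'(1)]
    note t = linear_map_closed[OF dX AX[OF x]]
    have t': "coact X' x \<in> carrier (tensor_space K X' C)"
      using linear_map_closed[OF coaction_linear[OF subcomodule_coaction[OF X'(1)]]] x X'A by simp
    have \<epsilon>0: "counit C (\<psi> y) = \<zero>\<^bsub>?K\<^esub>" if "y \<in> carrier X'" for y
    proof -
      have "counit C (\<psi> y) = counit D (\<eta> y)"
        using that X'A AX linear_map_closed[OF \<psi>] by (simp add: \<eta>_def coalgebra_hom_counit[OF f Ca Da])
      also have "\<dots> = \<zero>\<^bsub>?K\<^esub>"
        using that X'A linear_map_zero[OF coalgebra.counit_linear[OF Da]] by (simp add: A_def)
      finally show ?thesis .
    qed
    have "pure_tensor K ?K C \<one>\<^bsub>K\<^esub> (\<psi> x) = tensor_map K ?K C (counit C) (\<lambda>c. c) (comul C (\<psi> x))"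
      by (rule coalgebra.counit_left[OF Ca linear_map_closed[OF \<psi> AX[OF x]], symmetric])
    also have "\<dots> = tensor_map K ?K C (counit C) (\<lambda>c. c) (tensor_map K C C \<psi> (\<lambda>c. c) (coact X x))"
      by (simp add: \<psi>X AX x)
    also have "\<dots> = tensor_map K ?K C (\<lambda>x. counit C (\<psi> x)) (\<lambda>c. c) (coact X x)"
      by (rule tensor_map_comp[OF \<psi> Cid \<epsilon> Cid t])
    \<comment> \<open>Here the hypothesis enters: the coaction of \<open>x\<close> comes from A
      \<otimes> C. The functional \<open>counit C\<close> \<circ> \<psi> vanishes on
      \<open>A\<close>, so it has to be applied to a first factor that lies in
      \<open>A\<close>.\<close>
    also have "coact X x = tensor_map K X C (\<lambda>x. x) (\<lambda>c. c) (coact X' x)"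
      using subcomodule_coact[OF X'(1)] x X'A by simp
    also have "tensor_map K ?K C (\<lambda>x. counit C (\<psi> x)) (\<lambda>c. c) \<dots> =
        tensor_map K ?K C (\<lambda>x. counit C (\<psi> x)) (\<lambda>c. c) (coact X' x)"
      by (rule tensor_map_comp[OF i' Cid linear_map_comp[OF \<psi> \<epsilon>] Cid t'])
    also have "\<dots> = tensor_map K ?K C (\<lambda>x. \<zero>\<^bsub>?K\<^esub>) (\<lambda>c. c) (coact X' x)"
      by (rule tensor_map_cong[OF linear_map_const_zero[OF linear_map_dom[OF i'] linear_map_cod[OF \<epsilon>]]
            Cid _ _ t']) (simp_all add: \<epsilon>0)
    also have "\<dots> = \<zero>\<^bsub>tensor_space K ?K C\<^esub>"
      by (rule tensor_map_zero_left[OF linear_map_dom[OF i'] linear_map_cod[OF \<epsilon>] Cid t'])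
    finally show ?thesis
      by (rule base_space_tensor_cancel[OF coalgebra_vectorspace[OF Ca] linear_map_closed[OF \<psi> AX[OF x]]])
  qed
  \<comment> \<open>The copy \<phi> c lies in \<open>A\<close>, and \<psi> returns it to
    \<open>c\<close>.\<close>
  have "c = \<zero>\<^bsub>C\<^esub>" if "c \<in> carrier C" "f c = \<zero>\<^bsub>D\<^esub>" for c
    using \<psi>A[of "\<phi> c"] that linear_map_closed[OF \<phi>] by (simp add: A_def \<eta>_def \<psi>\<phi>)
  moreover interpret f: linear_map K C D f by (rule fl)
  interpret C: vectorspace K C by (rule coalgebra_vectorspace[OF Ca])
  have "f.ker = {\<zero>\<^bsub>C\<^esub>}"
    using calculation linear_map_zero[OF fl] by (auto simp: f.ker_def)
  then show ?thesis by (intro f.Ke0_imp_inj) simp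
qed

theorem lemma1p2:
  fixes K :: "('k, 'm) ring_scheme"
    and C :: "('k, 'c, 'n) coalgebra_scheme"
    and D :: "('k, 'd, 'o) coalgebra_scheme"
    and f :: "'c \<Rightarrow> 'd"
  assumes "field K"
    and "fin_dim_coalgebra K C"
    and "fin_dim_coalgebra K D"
    and "f \<in> coalgebra_hom K C D"
    and "fin_dim_universe K TYPE('x)"
  shows "inj_on f (carrier C) \<longleftrightarrow>
    (\<forall>X \<in> fin_dim_comodules K C. \<forall>Y \<in> fin_dim_comodules K C.
      \<forall>g \<in> comodule_hom K D (induced_obj K D f X) (induced_obj K D f Y).
        \<exists>h \<in> comodule_hom K C (X :: ('k, 'x, 'c) comodule) (Y :: ('k, 'x, 'c) comodule).
          induced_hom h = g) \<and>
    (\<forall>X \<in> fin_dim_comodules K C. \<forall>Y.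
      subcomodule K D Y (induced_obj K D f (X :: ('k, 'x, 'c) comodule)) \<longrightarrow>
        (\<exists>X'. subcomodule K C X' X \<and> induced_obj K D f X' = Y))"
    (is "_ \<longleftrightarrow> ?full \<and> ?closed")
proof
  assume inj: "inj_on f (carrier C)"
  show "?full \<and> ?closed"
  proof (intro conjI ballI allI impI)
    fix X Y :: "('k, 'x, 'c) comodule" and g
    assume "X \<in> fin_dim_comodules K C" "Y \<in> fin_dim_comodules K C"
      and "g \<in> comodule_hom K D (induced_obj K D f X) (induced_obj K D f Y)"
    then have "g \<in> comodule_hom K C X Y"
      by (intro induced_full[OF assms(2-4) inj]) (simp_all add: fin_dim_comodules_def)
    then show "\<exists>h\<in>comodule_hom K C X Y. induced_hom h = g"
      by (auto simp: induced_hom_def)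
  next
    fix X :: "('k, 'x, 'c) comodule" and Y
    assume "X \<in> fin_dim_comodules K C" "subcomodule K D Y (induced_obj K D f X)"
    then show "\<exists>X'. subcomodule K C X' X \<and> induced_obj K D f X' = Y"
      by (rule induced_subobject_closed[OF assms(2-4) inj])
  qed
next
  assume "?full \<and> ?closed"
  then show "inj_on f (carrier C)"
    by (intro subobject_closed_imp_inj[OF assms(2-5)]) blast
qed

end
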